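(* Let $d,p,s\in\mathbb{N}$, $m\in\mathbb{N}_0$, $\Theta\subset\mathbb{R}^p$, $\theta_0\in\Theta$ and $k=2p+1$. Let the noise sequences, the mappings $G_t^{(i,r)}$, and the random Fourier features $\varphi=(\varphi_1,\dots,\varphi_k)$ with random parameters $(\vartheta_1,\dots,\vartheta_k)$ be as in the context. Suppose the following hold. (A1) For each $n\in\mathbb{N}$, the observed and simulated time series of length $n$ are $X_t^{\mathrm{obs}}=G_t^{(n,0)}(\boldsymbol{\varepsilon}_t^{(0)},\theta_0)$ and $X_t^{(r)}(\theta)=G_t^{(n,r)}(\boldsymbol{\varepsilon}_t^{(r)},\theta)$, $t=1,\dots,n$, for all $r=1,\dots,s$ and $\theta\in\Theta$. (A2) For each $t\in\mathbb{N}$ and $r=0,1,\dots,s$ there is a measurable mapping $G_t^{(r)}:\mathbb{R}^\infty\times\Theta\to\mathbb{R}^d$ such that $(G_t^{(r)}(\boldsymbol{\varepsilon}_j,\theta))_{j\in\mathbb{Z}}$ is a stationary ergodic process, and for some $q>2$, as $n\to\infty$, $$\sup_{\theta\in\Theta}\Big(\frac1n\sum_{t=1}^n\big\|G_t^{(n,r)}(\boldsymbol{\varepsilon}_0,\theta)-G_t^{(r)}(\boldsymbol{\varepsilon}_0,\theta)\big\|_{\mathcal{L}^q(\theta)}\Big)\to0 .$$ (A3) Let $P_{\theta,t}^{(r)}$ denote the distribution of $[G_{t-m}^{(r)}(\boldsymbol{\varepsilon}_{-m},\theta),\dots,G_t^{(r)}(\boldsymbol{\varepsilon}_0,\theta)]^\top$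 and $\bar P_{\theta,n}^{(r)}=\frac1{n-m}\sum_{t=m+1}^nP_{\theta,t}^{(r)}$. For all $\theta\in\Theta$ there is a probability distribution $P_\theta$ on $\mathbb{R}^{(m+1)\times d}$ such that, for every bounded continuous $\phi:\mathbb{R}^{(m+1)\times d}\to\mathbb{R}$, as $n\to\infty$, $$\sup_{\theta\in\Theta}\max_{0\le r\le s}\Big|\int\phi\,d\bar P_{\theta,n}^{(r)}-\int\phi\,dP_\theta\Big|\to0 .$$ (A4) (i) $\Theta$ is a compact semialgebraic subset of $\mathbb{R}^p$ with non-empty interior. (ii) The map $\theta\mapsto P_\theta$ is injective. (iii) Writing $\psi_\theta$ for the characteristic function of $P_\theta$, the map $(\theta,\omega)\mapsto\psi_\theta(\omega)$ admits a jointly real analytic extension to $O\times\mathbb{R}^{(m+1)\times d}$, where $O\subset\mathbb{R}^p$ is an open neighborhood of $\Theta$. Define $\Phi:\Theta\to\mathbb{R}^k$ by $\Phi(\theta)=\int_{\mathbb{R}^{(m+1)\times d}}\varphi(x)\,dP_\theta(x)$ (the limiting expectations of the random Fourier features). Then, with probability one over the draw of the random parameters $(\vartheta_1,\dots,\vartheta_k)$, the mapping $\theta\mapsto\Phi(\theta)$ is one-to-one on $\Theta$.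
   Context: Noise. $(\varepsilon_i)_{i\in\mathbb{Z}}$ is an iid sequence of (real) random variables, and $(\varepsilon_i^{(r)})_{i\in\mathbb{Z}}$, $r=0,1,\dots,s$, are iid copies of this sequence. Put $\boldsymbol{\varepsilon}_t=(\varepsilon_t,\varepsilon_{t-1},\dots)$ and $\boldsymbol{\varepsilon}_t^{(r)}=(\varepsilon_t^{(r)},\varepsilon_{t-1}^{(r)},\dots)$. $\mathbb{R}^\infty$ carries the $\sigma$-algebra generated by all finite projections. Mappings. For each $t\in\mathbb{N}$, $i\in\mathbb{N}$, $r=0,1,\dots,s$, $G_t^{(i,r)}:\mathbb{R}^\infty\times\Theta\to\mathbb{R}^d$ is measurable and $(G_t^{(i,r)}(\boldsymbol{\varepsilon}_j,\theta))_{j\in\mathbb{Z}}$ is a stationary ergodic process for each $\theta$. Norms. $\|\cdot\|$ is the Euclidean norm; for a random vector $X$ whose law depends on $\theta$, $\|X\|_{\mathcal{L}^q(\theta)}=(\mathbb{E}_\theta\|X\|^q)^{1/q}$, where $\mathbb{E}_\theta$ is expectation under that $\theta$-dependent law. Random Fourier features. For $x=(x_1,\dots,x_{m+1})^\top\in\mathbb{R}^{(m+1)\times d}$ with $x_j\in\mathbb{R}^d$, $$\varphi_i(x)=\cos\Big(\sum_{j=1}^{m+1}\Omega_{i,j}\cdot x_j+\alpha_i\Big),\quad i=1,\dots,k,$$ with $\Omega_{i,j}\sim N(0,I_d)$ iid and $\alpha_i\sim U(-\pi,\pi)$ iid, all drawn independently of each other and of the data (noise). Put $\vartheta_i=(\Omega_{i,1}^\top,\dots,\Omega_{i,m+1}^\top,\alpha_i)^\top$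 and $\varphi=(\varphi_1,\dots,\varphi_k):\mathbb{R}^{(m+1)\times d}\to\mathbb{R}^k$. Semialgebraic set. A subset of $\mathbb{R}^p$ of the form $\bigcup_{i=1}^a\bigcap_{j=1}^{b_i}\{x\in\mathbb{R}^p: f_{i,j}(x)*_{i,j}0\}$ with $a,b_i\in\mathbb{N}$, $f_{i,j}$ real polynomials in $x_1,\dots,x_p$ and each $*_{i,j}$ either $<$ or $=$. A complex-valued function is real analytic if its real and imaginary parts are. *)

theory Defs
  imports "HOL-Probability.Probability"
begin

definition past :: "(int \<Rightarrow> 'a \<Rightarrow> real) \<Rightarrow> int \<Rightarrow> 'a \<Rightarrow> (nat \<Rightarrow> real)" where
  "past e t \<omega> = (\<lambda>k. e (t - int k) \<omega>)"

abbreviation seq_space :: "(nat \<Rightarrow> real) measure" where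
  "seq_space \<equiv> (\<Pi>\<^sub>M k\<in>UNIV. borel)"

definition iid_sequence :: "'a measure \<Rightarrow> (int \<Rightarrow> 'a \<Rightarrow> real) \<Rightarrow> bool" where
  "iid_sequence M e \<longleftrightarrow>
     prob_space.indep_vars M (\<lambda>_. borel) e UNIV \<and>
     (\<forall>i j. distr M borel (e i) = distr M borel (e j))"

definition iid_copies :: "'a measure \<Rightarrow> nat \<Rightarrow> (int \<Rightarrow> 'a \<Rightarrow> real) \<Rightarrow> (nat \<Rightarrow> int \<Rightarrow> 'a \<Rightarrow> real) \<Rightarrow> bool" where
  "iid_copies M s e e' \<longleftrightarrow>
     prob_space.indep_vars M (\<lambda>_. \<Pi>\<^sub>M i\<in>UNIV. borel) (\<lambda>r \<omega> i. e' r i \<omega>) {0..s} \<and>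
     (\<forall>r\<in>{0..s}. distr M (\<Pi>\<^sub>M i\<in>UNIV. borel) (\<lambda>\<omega> i. e' r i \<omega>) =
                 distr M (\<Pi>\<^sub>M i\<in>UNIV. borel) (\<lambda>\<omega> i. e i \<omega>))"

definition path_law :: "'a measure \<Rightarrow> (int \<Rightarrow> 'a \<Rightarrow> 'b::topological_space) \<Rightarrow> (int \<Rightarrow> 'b) measure" where
  "path_law M Y = distr M (\<Pi>\<^sub>M j\<in>UNIV. borel) (\<lambda>\<omega> j. Y j \<omega>)"

definition stationary_ergodic :: "'a measure \<Rightarrow> (int \<Rightarrow> 'a \<Rightarrow> 'b::topological_space) \<Rightarrow> bool" where
  "stationary_ergodic M Y \<longleftrightarrow>
     (\<forall>j. Y j \<in> borel_measurable M) \<and>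
     (\<forall>h. path_law M (\<lambda>j. Y (j + h)) = path_law M Y) \<and>
     (\<forall>A \<in> sets (path_law M Y). (\<lambda>y j. y (j + 1)) -` A = A \<longrightarrow> measure (path_law M Y) A \<in> {0, 1})"

text \<open>The \<open>L\<^sup>q\<close>-norm takes values in \<open>[0, \<infinity>]\<close>, so a missing moment counts as infinite.\<close>

definition Lq_norm :: "'a measure \<Rightarrow> real \<Rightarrow> ('a \<Rightarrow> 'b::real_normed_vector) \<Rightarrow> ennreal" where
  "Lq_norm M q X =
     (let I = (\<integral>\<^sup>+\<omega>. ennreal (norm (X \<omega>) powr q) \<partial>M)
      in if I = \<infinity> then \<infinity> else ennreal (enn2real I powr (1 / q)))"

text \<open>
  An element of \<open>\<real>\<^bsup>(m+1)\<times>d\<^esup>\<close> is an \<open>x :: real^'d^'l\<close> with \<open>CARD('l) = m + 1\<close>; a bijection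
  \<open>pos\<close> from \<open>'l\<close> onto \<open>{1..m+1}\<close> fixes the order of the rows, which is the order of time.
  In \<open>window_law\<close>, the row at position \<open>j\<close> is the mapping with index \<open>t - m + (j - 1)\<close>
  applied to the noise at time \<open>-m + (j - 1)\<close>; only \<open>t > m\<close> is relevant.
\<close>

definition window_law ::
  "'a measure \<Rightarrow> (int \<Rightarrow> 'a \<Rightarrow> real) \<Rightarrow> nat \<Rightarrow> ('l::finite \<Rightarrow> nat) \<Rightarrow>
   (nat \<Rightarrow> (nat \<Rightarrow> real) \<Rightarrow> real^'p \<Rightarrow> real^'d) \<Rightarrow> real^'p \<Rightarrow> nat \<Rightarrow> (real^'d^'l) measure" where
  "window_law M e m pos H \<theta> t =
     distr M borel (\<lambda>\<omega>. \<chi> j. H (t + pos j - (m + 1)) (past e (int (pos j) - int (m + 1)) \<omega>) \<theta>)"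

definition average_law :: "nat \<Rightarrow> (nat \<Rightarrow> 'b::topological_space measure) \<Rightarrow> nat \<Rightarrow> 'b measure" where
  "average_law m Q n =
     measure_of UNIV (sets borel) (\<lambda>A. (\<Sum>t\<in>{m+1..n}. emeasure (Q t) A) / of_nat (n - m))"

lemma sets_average_law [simp]: "sets (average_law m Q n) = sets borel"
  unfolding average_law_def using sets.sigma_sets_eq[of borel] by (simp add: sets_measure_of)

lemma emeasure_average_law:
  assumes "\<And>t. t \<in> {m+1..n} \<Longrightarrow> sets (Q t) = sets borel" "A \<in> sets borel"
  shows "emeasure (average_law m Q n) A = (\<Sum>t\<in>{m+1..n}. emeasure (Q t) A) / of_nat (n - m)"
proof (rule emeasure_measure_of[OF average_law_def])
  show "countably_additive (sets (average_law m Q n))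
      (\<lambda>A. (\<Sum>t\<in>{m+1..n}. emeasure (Q t) A) / of_nat (n - m))"
  proof (rule countably_additiveI)
    fix B :: "nat \<Rightarrow> _ set"
    assume B: "range B \<subseteq> sets (average_law m Q n)" "disjoint_family B"
    have "(\<Sum>i. (\<Sum>t\<in>{m+1..n}. emeasure (Q t) (B i)) / of_nat (n - m))
        = (\<Sum>i. \<Sum>t\<in>{m+1..n}. emeasure (Q t) (B i)) / of_nat (n - m)"
      by (rule ennreal_suminf_divide)
    also have "(\<Sum>i. \<Sum>t\<in>{m+1..n}. emeasure (Q t) (B i)) = (\<Sum>t\<in>{m+1..n}. \<Sum>i. emeasure (Q t) (B i))"
      by (rule suminf_sum) simp
    also have "\<dots> = (\<Sum>t\<in>{m+1..n}. emeasure (Q t) (\<Union>i. B i))"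
      using B assms(1) by (intro sum.cong refl suminf_emeasure) auto
    finally show "(\<Sum>i. (\<Sum>t\<in>{m+1..n}. emeasure (Q t) (B i)) / of_nat (n - m))
        = (\<Sum>t\<in>{m+1..n}. emeasure (Q t) (\<Union>i. B i)) / of_nat (n - m)" .
  qed
qed (use assms in \<open>auto simp: positive_def\<close>)

definition std_normal_vector :: "'a measure \<Rightarrow> ('a \<Rightarrow> real^'d) \<Rightarrow> bool" where
  "std_normal_vector M X \<longleftrightarrow>
     distributed M lborel X
       (\<lambda>x. ennreal ((2 * pi) powr (- real CARD('d) / 2) * exp (- (norm x)\<^sup>2 / 2)))"

text \<open>
  The parameters \<open>\<Omega> i j\<close>, \<open>\<alpha> i\<close> and the noise take values in different spaces, so their joint
  independence is stated for the generated \<open>\<sigma>\<close>-algebras. All noise sequences together form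
  the single index \<open>Inr (Inr ())\<close>.
\<close>

definition generated_sets :: "'a measure \<Rightarrow> ('a \<Rightarrow> 'b::topological_space) \<Rightarrow> 'a set set" where
  "generated_sets M X = {X -` A \<inter> space M | A. A \<in> sets borel}"

definition noise_sets ::
  "'a measure \<Rightarrow> nat \<Rightarrow> (int \<Rightarrow> 'a \<Rightarrow> real) \<Rightarrow> (nat \<Rightarrow> int \<Rightarrow> 'a \<Rightarrow> real) \<Rightarrow> 'a set set" where
  "noise_sets M s e e' =
     sigma_sets (space M)
       ((\<Union>i. generated_sets M (e i)) \<union> (\<Union>r\<in>{0..s}. \<Union>i. generated_sets M (e' r i)))"

definition random_feature_parameters ::
  "'a measure \<Rightarrow> nat \<Rightarrow> (int \<Rightarrow> 'a \<Rightarrow> real) \<Rightarrow> (nat \<Rightarrow> int \<Rightarrow> 'a \<Rightarrow> real) \<Rightarrow>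
   ('k \<Rightarrow> 'l \<Rightarrow> 'a \<Rightarrow> real^'d) \<Rightarrow> ('k \<Rightarrow> 'a \<Rightarrow> real) \<Rightarrow> bool" where
  "random_feature_parameters M s e e' \<Omega> \<alpha> \<longleftrightarrow>
     (\<forall>i j. std_normal_vector M (\<Omega> i j)) \<and>
     (\<forall>i. \<alpha> i \<in> borel_measurable M \<and> distr M lborel (\<alpha> i) = uniform_measure lborel {-pi<..<pi}) \<and>
     prob_space.indep_sets M
       (case_sum (\<lambda>(i, j). generated_sets M (\<Omega> i j))
         (case_sum (\<lambda>i. generated_sets M (\<alpha> i)) (\<lambda>_::unit. noise_sets M s e e')))
       UNIV"

definition fourier_features ::
  "('k::finite \<Rightarrow> 'l::finite \<Rightarrow> real^'d) \<Rightarrow> ('k \<Rightarrow> real) \<Rightarrow> real^'d^'l \<Rightarrow> real^'k" where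
  "fourier_features w a x = (\<chi> i. cos ((\<Sum>j\<in>UNIV. w i j \<bullet> (x $ j)) + a i))"

definition semialgebraic :: "(real^'p) set \<Rightarrow> bool" where
  "semialgebraic S \<longleftrightarrow>
     (\<exists>(a::nat) (b::nat \<Rightarrow> nat) (f :: nat \<Rightarrow> nat \<Rightarrow> real^'p \<Rightarrow> real) (rel :: nat \<Rightarrow> nat \<Rightarrow> real \<Rightarrow> real \<Rightarrow> bool).
        a \<ge> 1 \<and>
        (\<forall>i\<in>{1..a}. b i \<ge> 1 \<and>
           (\<forall>j\<in>{1..b i}. real_polynomial_function (f i j) \<and> rel i j \<in> {(<), (=)})) \<and>
        S = (\<Union>i\<in>{1..a}. \<Inter>j\<in>{1..b i}. {x. rel i j (f i j x) 0}))"

text \<open>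
  Multi-indices are functions \<open>\<nu>\<close> vanishing off \<open>Basis\<close>; \<open>has_sum\<close> is unconditional, hence
  absolute, convergence of the multivariate power series.
\<close>

definition real_analytic_on :: "('b::euclidean_space \<Rightarrow> real) \<Rightarrow> 'b set \<Rightarrow> bool" where
  "real_analytic_on f U \<longleftrightarrow> open U \<and>
     (\<forall>x\<in>U. \<exists>(c :: ('b \<Rightarrow> nat) \<Rightarrow> real) \<rho>. \<rho> > 0 \<and> ball x \<rho> \<subseteq> U \<and>
        (\<forall>y\<in>ball x \<rho>.
           ((\<lambda>\<nu>. c \<nu> * (\<Prod>b\<in>Basis. ((y - x) \<bullet> b) ^ \<nu> b)) has_sum f y)
             {\<nu>. \<forall>b. b \<notin> Basis \<longrightarrow> \<nu> b = 0}))"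

definition complex_real_analytic_on :: "('b::euclidean_space \<Rightarrow> complex) \<Rightarrow> 'b set \<Rightarrow> bool" where
  "complex_real_analytic_on f U \<longleftrightarrow>
     real_analytic_on (\<lambda>x. Re (f x)) U \<and> real_analytic_on (\<lambda>x. Im (f x)) U"

definition char_fun :: "'b::euclidean_space measure \<Rightarrow> 'b \<Rightarrow> complex" where
  "char_fun Q \<omega> = (CLINT x|Q. iexp (\<omega> \<bullet> x))"

end

theory Submission
  imports Defs
begin

text \<open>
  Write \<open>\<psi>\<close> for the analytic extension of the characteristic functions. The \<open>i\<close>-th component of
  \<open>\<Phi>(\<theta>) - \<Phi>(\<theta>')\<close> is \<open>g(y, \<vartheta>\<^sub>i) = Re (e\<^sup>i\<^sup>\<alpha> (\<psi>(\<theta>, \<omega>) - \<psi>(\<theta>', \<omega>)))\<close> with \<open>y = (\<theta>, \<theta>')\<close> and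
  \<open>\<vartheta>\<^sub>i = (\<omega>, \<alpha>)\<close>. For \<open>\<theta> \<noteq> \<theta>'\<close> this is a nonzero analytic function of \<open>\<vartheta>\<^sub>i\<close>, so each of its zeros
  is also a zero of one of countably many functions (\<open>g\<close> itself, or an \<open>\<omega>\<close>-derivative of the real or
  imaginary part of the difference) whose derivative in some fixed direction \<open>v\<close> does not vanish there.
  Along lines in direction \<open>v\<close> such a zero is a locally Lipschitz function of \<open>y\<close>. Hence, after moving
  each of the \<open>k = 2p + 1\<close> parameters along its own line, the parameters admitting a common zero form
  locally a Lipschitz image of a subset of the \<open>2p\<close>-dimensional space of pairs \<open>y\<close> in \<open>\<real>\<^sup>k\<close>, which is
  a null set. Fubini and countability finish the argument; neither an implicit function theorem nor
  any stratification of zero sets is needed.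
\<close>

section \<open>Real analytic functions of several variables\<close>

text \<open>A pair \<open>y\<close> ranges over an uncountable set, so it is not enough that for
  each fixed \<open>y\<close> almost every choice of the parameters avoids a common zero; the
  exceptional sets have to be united by a dimension count. Lipschitz dependence is where such a
  count could fail: near a degenerate zero, as for t^3 = y at 0, the zero depends on
  \<open>y\<close> in a Hoelder way only, and Hoelder images can gain dimension. Passing to a
  derivative with a simple zero repairs this, because the derivative is again a function of the same
  \<open>y\<close>. Such a derivative exists since otherwise agreement of the slices at theta and
  theta' at one frequency would propagate through all derivatives and, by the identity theorem, to
  all frequencies, against the injectivity of the laws and the uniqueness theorem for characteristic
  functions. Moving the phase handles the points where the two values of psi differ; where they
  coincide, g vanishes for every phase and only the frequency can be moved.\<close>

definition multi_indices :: "('b::euclidean_space \<Rightarrow> nat) set" where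
  "multi_indices = {\<nu>. \<forall>b. b \<notin> Basis \<longrightarrow> \<nu> b = 0}"

definition monomial :: "('b::euclidean_space \<Rightarrow> nat) \<Rightarrow> 'b \<Rightarrow> real" where
  "monomial \<nu> z = (\<Prod>b\<in>Basis. (z \<bullet> b) ^ \<nu> b)"

definition total_degree :: "('b::euclidean_space \<Rightarrow> nat) \<Rightarrow> nat" where
  "total_degree \<nu> = (\<Sum>b\<in>Basis. \<nu> b)"

definition power_series_at ::
  "(('b::euclidean_space \<Rightarrow> nat) \<Rightarrow> real) \<Rightarrow> ('b \<Rightarrow> real) \<Rightarrow> 'b \<Rightarrow> real \<Rightarrow> bool" where
  "power_series_at c f x \<rho> \<longleftrightarrow>
     \<rho> > 0 \<and> (\<forall>z. norm z < \<rho> \<longrightarrow> ((\<lambda>\<nu>. c \<nu> * monomial \<nu> z) has_sum f (x + z)) multi_indices)"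

lemma real_analytic_on_iff:
  "real_analytic_on f U \<longleftrightarrow> open U \<and> (\<forall>x\<in>U. \<exists>c \<rho>. ball x \<rho> \<subseteq> U \<and> power_series_at c f x \<rho>)"
proof -
  have "(\<forall>y\<in>ball x \<rho>. ((\<lambda>\<nu>. c \<nu> * (\<Prod>b\<in>Basis. ((y - x) \<bullet> b) ^ \<nu> b)) has_sum f y)
             {\<nu>. \<forall>b. b \<notin> Basis \<longrightarrow> \<nu> b = 0})
     \<longleftrightarrow> (\<forall>z. norm z < \<rho> \<longrightarrow> ((\<lambda>\<nu>. c \<nu> * monomial \<nu> z) has_sum f (x + z)) multi_indices)"
    (is "?L \<longleftrightarrow> ?R") for x :: 'a and c \<rho>
  proof
    assume L: ?L
    show ?R
    proof (intro allI impI)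
      fix z :: 'a assume "norm z < \<rho>"
      then have "x + z \<in> ball x \<rho>" by (simp add: dist_norm)
      from bspec[OF L this] show "((\<lambda>\<nu>. c \<nu> * monomial \<nu> z) has_sum f (x + z)) multi_indices"
        by (simp add: monomial_def multi_indices_def)
    qed
  next
    assume R: ?R
    show ?L
    proof
      fix y assume "y \<in> ball x \<rho>"
      then have "norm (y - x) < \<rho>" by (simp add: dist_norm norm_minus_commute)
      from R[rule_format, OF this]
      show "((\<lambda>\<nu>. c \<nu> * (\<Prod>b\<in>Basis. ((y - x) \<bullet> b) ^ \<nu> b)) has_sum f y)
             {\<nu>. \<forall>b. b \<notin> Basis \<longrightarrow> \<nu> b = 0}"
        by (simp add: monomial_def multi_indices_def)
    qed
  qed
  then show ?thesis
    unfolding real_analytic_on_def power_series_at_def by (simp only: conj_left_commute)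
qed

section \<open>Size estimates for monomials and power series\<close>

lemma monomial_scaleR: "monomial \<nu> (r *\<^sub>R z) = r ^ total_degree \<nu> * monomial \<nu> z"
  by (simp add: monomial_def total_degree_def power_mult_distrib prod.distrib power_sum)

text \<open>By homogeneity it suffices to treat vectors with coordinates in [-1, 1]; there two
  products differ by at most the sum of the differences of their factors, and a power with exponent
  n changes by at most n times the change of its base.\<close>

lemma monomial_diff_le:
  fixes z w :: "'b::euclidean_space"
  assumes "r > 0" "\<And>b. b \<in> Basis \<Longrightarrow> \<bar>z \<bullet> b\<bar> \<le> r" "\<And>b. b \<in> Basis \<Longrightarrow> \<bar>w \<bullet> b\<bar> \<le> r"
  shows "\<bar>monomial \<nu> z - monomial \<nu> w\<bar>
           \<le> r ^ total_degree \<nu> * (total_degree \<nu> / r) * norm (z - w)"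
proof -
  define u where "u = (1 / r) *\<^sub>R z"
  define v where "v = (1 / r) *\<^sub>R w"
  have zw: "z = r *\<^sub>R u" "w = r *\<^sub>R v" using \<open>r > 0\<close> by (auto simp: u_def v_def)
  have u: "\<bar>u \<bullet> b\<bar> \<le> 1" and v: "\<bar>v \<bullet> b\<bar> \<le> 1" if "b \<in> Basis" for b
    using assms(1) assms(2,3)[OF that] by (auto simp: u_def v_def abs_mult divide_simps)
  have "\<bar>monomial \<nu> u - monomial \<nu> v\<bar> \<le> (\<Sum>b\<in>Basis. \<bar>(u \<bullet> b) ^ \<nu> b - (v \<bullet> b) ^ \<nu> b\<bar>)"
    unfolding monomial_def real_norm_def[symmetric]
    by (intro norm_prod_diff) (auto simp: power_abs u v power_le_one)
  also have "\<dots> \<le> (\<Sum>b\<in>Basis. \<nu> b * norm (u - v))"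
  proof (rule sum_mono)
    fix b :: 'b assume b: "b \<in> Basis"
    have "\<bar>(u \<bullet> b) ^ \<nu> b - (v \<bullet> b) ^ \<nu> b\<bar> \<le> \<nu> b * \<bar>u \<bullet> b - v \<bullet> b\<bar>"
      using norm_power_diff[of "u \<bullet> b" "v \<bullet> b" "\<nu> b"] u[OF b] v[OF b] by simp
    also have "\<bar>u \<bullet> b - v \<bullet> b\<bar> \<le> norm (u - v)"
      using Basis_le_norm[OF b, of "u - v"] by (simp add: inner_diff_left)
    finally show "\<bar>(u \<bullet> b) ^ \<nu> b - (v \<bullet> b) ^ \<nu> b\<bar> \<le> \<nu> b * norm (u - v)"
      by (simp add: mult_left_mono)
  qed
  also have "\<dots> = total_degree \<nu> * norm (u - v)"
    by (simp add: total_degree_def sum_distrib_right)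
  also have "norm (u - v) = norm (z - w) / r"
    using \<open>r > 0\<close> by (simp add: u_def v_def flip: scaleR_diff_right)
  finally have "\<bar>monomial \<nu> u - monomial \<nu> v\<bar> \<le> (total_degree \<nu> / r) * norm (z - w)"
    by simp
  then have "r ^ total_degree \<nu> * \<bar>monomial \<nu> u - monomial \<nu> v\<bar>
      \<le> r ^ total_degree \<nu> * ((total_degree \<nu> / r) * norm (z - w))"
    using \<open>r > 0\<close> by (intro mult_left_mono) auto
  moreover have "monomial \<nu> z - monomial \<nu> w = r ^ total_degree \<nu> * (monomial \<nu> u - monomial \<nu> v)"
    unfolding zw monomial_scaleR by (simp only: right_diff_distrib)
  ultimately show ?thesis using \<open>r > 0\<close> by (simp add: abs_mult mult.assoc)
qed

text \<open>The squared exponent is a crude constant that survives the induction: the new error is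
  (y + t) times the old one plus n t^2 y^(n-1), and n^2 + n \<le> (n + 1)^2.\<close>

lemma power_taylor_le:
  fixes y t :: real
  assumes "\<bar>y\<bar> \<le> 1" "\<bar>y + t\<bar> \<le> 1"
  shows "\<bar>(y + t) ^ n - y ^ n - n * t * y ^ (n - 1)\<bar> \<le> (real n)\<^sup>2 * t\<^sup>2"
proof (induction n)
  case (Suc n)
  define E where "E = (y + t) ^ n - y ^ n - n * t * y ^ (n - 1)"
  have "(y + t) ^ Suc n - y ^ Suc n - Suc n * t * y ^ n = (y + t) * E + n * t\<^sup>2 * y ^ (n - 1)"
    unfolding E_def by (cases n) (simp_all add: algebra_simps power2_eq_square)
  also have "\<bar>\<dots>\<bar> \<le> \<bar>(y + t) * E\<bar> + \<bar>n * t\<^sup>2 * y ^ (n - 1)\<bar>" by (rule abs_triangle_ineq)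
  also have "\<bar>(y + t) * E\<bar> \<le> 1 * ((real n)\<^sup>2 * t\<^sup>2)"
    unfolding abs_mult using Suc assms by (intro mult_mono) (auto simp: E_def)
  also have "\<bar>n * t\<^sup>2 * y ^ (n - 1)\<bar> \<le> n * t\<^sup>2 * 1"
    unfolding abs_mult using assms by (intro mult_mono) (auto simp: power_abs power_le_one)
  finally have "\<bar>(y + t) ^ Suc n - y ^ Suc n - Suc n * t * y ^ n\<bar> \<le> (real n)\<^sup>2 * t\<^sup>2 + n * t\<^sup>2"
    by simp
  also have "\<dots> \<le> (real (Suc n))\<^sup>2 * t\<^sup>2"
    using mult_nonneg_nonneg[of "real n + 1" "t\<^sup>2"] by (simp add: power2_eq_square algebra_simps)
  finally show ?case by simp
qed simp

text \<open>Only the coordinate along \<open>b\<close> moves, so all other factors split off as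
  \<open>P\<close>; dividing by \<open>r\<close> reduces the rest to one variable in [-1, 1]. For
  exponent 0 the truncated \<open>\<nu> b - 1\<close> is harmless, being multiplied by
  \<open>\<nu> b\<close>.\<close>

lemma monomial_taylor_le:
  fixes z b :: "'b::euclidean_space"
  assumes "r > 0" "b \<in> Basis"
    and z: "\<And>a. a \<in> Basis \<Longrightarrow> \<bar>z \<bullet> a\<bar> \<le> r" and zt: "\<bar>z \<bullet> b + t\<bar> \<le> r"
  shows "\<bar>monomial \<nu> (z + t *\<^sub>R b) - monomial \<nu> z - t * (\<nu> b * monomial (\<nu>(b := \<nu> b - 1)) z)\<bar>
           \<le> r ^ total_degree \<nu> * (total_degree \<nu> / r)\<^sup>2 * t\<^sup>2"
proof -
  define P where "P = (\<Prod>a\<in>Basis - {b}. (z \<bullet> a) ^ \<nu> a)"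
  define R where "R = (\<Prod>a\<in>Basis - {b}. r ^ \<nu> a)"
  have deg: "r ^ total_degree \<nu> = r ^ \<nu> b * R"
    unfolding total_degree_def power_sum R_def
    using assms(2) by (subst prod.remove[of _ b]) auto
  have P: "\<bar>P\<bar> \<le> R"
    unfolding P_def R_def abs_prod power_abs by (intro prod_mono) (auto intro!: power_mono z)
  have "R \<ge> 0" unfolding R_def using \<open>r > 0\<close> by (intro prod_nonneg) auto
  have m0: "monomial \<nu> z = (z \<bullet> b) ^ \<nu> b * P"
    unfolding monomial_def P_def using assms(2) by (subst prod.remove[of _ b]) auto
  have m1: "monomial \<nu> (z + t *\<^sub>R b) = (z \<bullet> b + t) ^ \<nu> b * P"
  proof -
    have "(\<Prod>a\<in>Basis - {b}. ((z + t *\<^sub>R b) \<bullet> a) ^ \<nu> a) = P"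
      unfolding P_def using assms(2)
      by (intro prod.cong) (auto simp: inner_add_left inner_Basis)
    then show ?thesis
      unfolding monomial_def using assms(2)
      by (subst prod.remove[of _ b]) (auto simp: inner_add_left inner_Basis)
  qed
  have m2: "monomial (\<nu>(b := \<nu> b - 1)) z = (z \<bullet> b) ^ (\<nu> b - 1) * P"
    unfolding monomial_def P_def using assms(2) by (subst prod.remove[of _ b]) auto
  define y where "y = (z \<bullet> b) / r"
  define s where "s = t / r"
  have ys: "z \<bullet> b = r * y" "t = r * s" using \<open>r > 0\<close> by (auto simp: y_def s_def)
  have "\<bar>y\<bar> \<le> 1" "\<bar>y + s\<bar> \<le> 1"
    using z[OF assms(2)] zt \<open>r > 0\<close> by (auto simp: y_def s_def abs_le_iff divide_simps)
  then have "\<bar>(y + s) ^ \<nu> b - y ^ \<nu> b - \<nu> b * s * y ^ (\<nu> b - 1)\<bar> \<le> (real (\<nu> b))\<^sup>2 * s\<^sup>2"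
    by (rule power_taylor_le)
  also have "\<dots> \<le> (real (total_degree \<nu>))\<^sup>2 * s\<^sup>2"
    using member_le_sum[of b Basis \<nu>] assms(2)
    by (intro mult_right_mono power_mono) (auto simp: total_degree_def simp del: of_nat_sum)
  finally have *: "\<bar>(y + s) ^ \<nu> b - y ^ \<nu> b - \<nu> b * s * y ^ (\<nu> b - 1)\<bar>
      \<le> (real (total_degree \<nu>))\<^sup>2 * s\<^sup>2" .
  have "monomial \<nu> (z + t *\<^sub>R b) - monomial \<nu> z - t * (\<nu> b * monomial (\<nu>(b := \<nu> b - 1)) z)
     = ((z \<bullet> b + t) ^ \<nu> b - (z \<bullet> b) ^ \<nu> b - \<nu> b * t * (z \<bullet> b) ^ (\<nu> b - 1)) * P"
    unfolding m0 m1 m2 by (simp add: algebra_simps)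
  also have "(z \<bullet> b + t) ^ \<nu> b - (z \<bullet> b) ^ \<nu> b - \<nu> b * t * (z \<bullet> b) ^ (\<nu> b - 1)
     = r ^ \<nu> b * ((y + s) ^ \<nu> b - y ^ \<nu> b - \<nu> b * s * y ^ (\<nu> b - 1))"
    unfolding ys distrib_left[symmetric] power_mult_distrib
    by (cases "\<nu> b") (simp_all add: right_diff_distrib mult_ac)
  finally have "\<bar>monomial \<nu> (z + t *\<^sub>R b) - monomial \<nu> z - t * (\<nu> b * monomial (\<nu>(b := \<nu> b - 1)) z)\<bar>
      = r ^ \<nu> b * \<bar>(y + s) ^ \<nu> b - y ^ \<nu> b - \<nu> b * s * y ^ (\<nu> b - 1)\<bar> * \<bar>P\<bar>"
    using \<open>r > 0\<close> by (simp only: abs_mult power_abs abs_of_pos)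
  also have "\<dots> \<le> r ^ \<nu> b * ((real (total_degree \<nu>))\<^sup>2 * s\<^sup>2) * R"
    using * P \<open>r > 0\<close> by (intro mult_mono mult_left_mono) auto
  also have "\<dots> = r ^ total_degree \<nu> * (total_degree \<nu> / r)\<^sup>2 * t\<^sup>2"
    using \<open>r > 0\<close> by (simp add: deg s_def power_divide)
  finally show ?thesis .
qed

text \<open>Lets a polynomial factor in the degree be paid for by halving the radius. After taking
  roots, up to rounding, the bound is an induction in steps of two: the left side grows by 2 while
  the right side doubles.\<close>

lemma Suc_sq_le_four_power: "(real n + 1)\<^sup>2 \<le> 4 * 2 ^ n"
proof -
  have "real n + 1 \<le> 2 * 2 ^ (n div 2)" for n
  proof (induction n rule: less_induct)
    case (less n)
    show ?case
    proof (cases "n < 4")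
      case True
      then consider "n = 0" | "n = 1" | "n = 2" | "n = 3" by linarith
      then show ?thesis by cases auto
    next
      case False
      define m where "m = n - 2"
      have n: "n = m + 2" "m \<ge> 2" using False by (auto simp: m_def)
      from less[of m] n have "real m + 1 \<le> 2 * 2 ^ (m div 2)" by simp
      then show ?thesis using n by simp
    qed
  qed
  note this[of n]
  then have "(real n + 1)\<^sup>2 \<le> (2 * 2 ^ (n div 2))\<^sup>2" by (intro power_mono) auto
  also have "\<dots> = 4 * 2 ^ (n div 2 * 2)" unfolding power_mult by (simp add: power_mult_distrib)
  also have "\<dots> \<le> 4 * 2 ^ n" by (intro mult_left_mono power_increasing) auto
  finally show ?thesis .
qed

text \<open>Convergence at a corner of a cube, where every monomial equals a power of the half side,
  bounds all coefficients at once, since unconditional convergence of a real series is absolute. The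
  weight, the square of degree plus one, majorises the factors that the Lipschitz and Taylor
  estimates bring in.\<close>

lemma power_series_at_summable:
  fixes f :: "'b::euclidean_space \<Rightarrow> real"
  assumes "power_series_at c f x \<rho>"
  obtains r where "r > 0" "\<forall>z::'b. (\<forall>b\<in>Basis. \<bar>z \<bullet> b\<bar> \<le> r) \<longrightarrow> norm z < \<rho>"
    "(\<lambda>\<nu>. \<bar>c \<nu>\<bar> * r ^ total_degree \<nu> * (real (total_degree \<nu>) + 1)\<^sup>2) summable_on multi_indices"
proof -
  have \<rho>: "\<rho> > 0" using assms by (simp add: power_series_at_def)
  \<comment> \<open>The 1-norm of a point of the cube with half side \<open>s\<close> is at most
    \<rho> / 2, so the closed cube stays inside the open ball.\<close>
  define s where "s = \<rho> / (2 * DIM('b))"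
  have "s > 0" using \<rho> by (simp add: s_def)
  have cube: "norm z < \<rho>" if "\<And>b. b \<in> Basis \<Longrightarrow> \<bar>z \<bullet> b\<bar> \<le> s" for z :: 'b
  proof -
    have "norm z \<le> (\<Sum>b\<in>Basis. \<bar>z \<bullet> b\<bar>)" by (rule norm_le_l1)
    also have "\<dots> \<le> DIM('b) * s" using that by (rule sum_bounded_above)
    also have "\<dots> < \<rho>" using \<rho> by (simp add: s_def)
    finally show ?thesis .
  qed
  define z :: 'b where "z = s *\<^sub>R One"
  have "norm z < \<rho>" by (rule cube) (use \<open>s > 0\<close> in \<open>simp add: z_def\<close>)
  then have "((\<lambda>\<nu>. c \<nu> * monomial \<nu> z) has_sum f (x + z)) multi_indices"
    using assms by (simp add: power_series_at_def)
  moreover have "monomial \<nu> z = s ^ total_degree \<nu>" for \<nu>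
    unfolding z_def monomial_scaleR by (simp add: monomial_def)
  ultimately have "(\<lambda>\<nu>. c \<nu> * s ^ total_degree \<nu>) summable_on multi_indices"
    by (simp add: has_sum_imp_summable)
  then have "(\<lambda>\<nu>. norm (c \<nu> * s ^ total_degree \<nu>)) summable_on multi_indices"
    by (rule summable_on_iff_abs_summable_on_real[THEN iffD1])
  then have s_sum: "(\<lambda>\<nu>. 4 * (\<bar>c \<nu>\<bar> * s ^ total_degree \<nu>)) summable_on multi_indices"
    using \<open>s > 0\<close> by (intro summable_on_cmult_right) (simp add: abs_mult)
  show ?thesis
  proof (rule that)
    show "s / 2 > 0" using \<open>s > 0\<close> by simp
    show "\<forall>z::'b. (\<forall>b\<in>Basis. \<bar>z \<bullet> b\<bar> \<le> s / 2) \<longrightarrow> norm z < \<rho>"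
      using \<open>s > 0\<close> by (force intro!: cube)
    show "(\<lambda>\<nu>. \<bar>c \<nu>\<bar> * (s / 2) ^ total_degree \<nu> * (real (total_degree \<nu>) + 1)\<^sup>2) summable_on multi_indices"
    proof (rule summable_on_comparison_test[OF s_sum])
      fix \<nu> :: "'b \<Rightarrow> nat"
      let ?n = "total_degree \<nu>"
      have "\<bar>c \<nu>\<bar> * (s / 2) ^ ?n * (real ?n + 1)\<^sup>2 \<le> \<bar>c \<nu>\<bar> * (s / 2) ^ ?n * (4 * 2 ^ ?n)"
        using \<open>s > 0\<close> by (intro mult_left_mono Suc_sq_le_four_power) auto
      also have "\<dots> = 4 * (\<bar>c \<nu>\<bar> * s ^ ?n)" by (simp add: power_divide)
      finally show "\<bar>c \<nu>\<bar> * (s / 2) ^ ?n * (real ?n + 1)\<^sup>2 \<le> 4 * (\<bar>c \<nu>\<bar> * s ^ ?n)" .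
    qed (use \<open>s > 0\<close> in auto)
  qed
qed

lemma has_sum_diff_real:
  fixes u v :: "'i \<Rightarrow> real"
  assumes "(u has_sum a) A" "(v has_sum b) A"
  shows "((\<lambda>x. u x - v x) has_sum a - b) A"
proof -
  have "((\<lambda>x. - v x) has_sum - b) A" using assms(2) by (simp add: has_sum_uminus)
  from has_sum_add[OF assms(1) this] show ?thesis by simp
qed

lemma abs_has_sum_le_infsum:
  fixes u g :: "'i \<Rightarrow> real"
  assumes u: "(u has_sum a) A" and g: "g summable_on A" and le: "\<And>x. x \<in> A \<Longrightarrow> \<bar>u x\<bar> \<le> g x"
  shows "\<bar>a\<bar> \<le> infsum g A"
proof -
  have g': "(g has_sum infsum g A) A" using g by simp
  have "a \<le> infsum g A"
    using has_sum_mono[OF u g'] le by (simp add: abs_le_iff)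
  moreover have "((\<lambda>x. - u x) has_sum - a) A"
    using u by (simp add: has_sum_uminus)
  from has_sum_mono[OF this g'] have "- a \<le> infsum g A"
    using le by (simp add: abs_le_iff)
  ultimately show ?thesis by simp
qed

text \<open>The bounds of \<open>monomial_diff_le\<close> are summed against the
  coefficients.\<close>

lemma power_series_at_lipschitz:
  fixes f :: "'b::euclidean_space \<Rightarrow> real"
  assumes f: "power_series_at c f x \<rho>"
  obtains r L where "r > 0" "L \<ge> 0"
    "\<forall>z w. norm z < r \<and> norm w < r \<longrightarrow> \<bar>f (x + z) - f (x + w)\<bar> \<le> L * norm (z - w)"
proof -
  obtain r where r: "r > 0" "\<forall>z::'b. (\<forall>b\<in>Basis. \<bar>z \<bullet> b\<bar> \<le> r) \<longrightarrow> norm z < \<rho>"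
    and sm: "(\<lambda>\<nu>. \<bar>c \<nu>\<bar> * r ^ total_degree \<nu> * (real (total_degree \<nu>) + 1)\<^sup>2) summable_on multi_indices"
    by (rule power_series_at_summable[OF f])
  define g where "g = (\<lambda>\<nu>::'b\<Rightarrow>nat. \<bar>c \<nu>\<bar> * r ^ total_degree \<nu> * (real (total_degree \<nu>) + 1)\<^sup>2)"
  have g0: "g \<nu> \<ge> 0" for \<nu> using r by (simp add: g_def)
  show ?thesis
  proof (rule that)
    show "r > 0" by fact
    show "infsum g multi_indices / r \<ge> 0"
      using r g0 by (simp add: infsum_nonneg)
    show "\<forall>z w. norm z < r \<and> norm w < r \<longrightarrow>
        \<bar>f (x + z) - f (x + w)\<bar> \<le> infsum g multi_indices / r * norm (z - w)"
    proof (intro allI impI, elim conjE)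
      fix z w :: 'b assume "norm z < r" "norm w < r"
      then have zr: "\<bar>z \<bullet> b\<bar> \<le> r" and wr: "\<bar>w \<bullet> b\<bar> \<le> r" if "b \<in> Basis" for b
        using Basis_le_norm[OF that, of z] Basis_le_norm[OF that, of w] by auto
      have "norm z < \<rho>" "norm w < \<rho>" using r(2) zr wr by auto
      then have "((\<lambda>\<nu>. c \<nu> * monomial \<nu> z) has_sum f (x + z)) multi_indices"
        "((\<lambda>\<nu>. c \<nu> * monomial \<nu> w) has_sum f (x + w)) multi_indices"
        using f by (auto simp: power_series_at_def)
      note has_sum_diff_real[OF this]
      moreover have "(\<lambda>\<nu>. g \<nu> * (norm (z - w) / r)) summable_on multi_indices"
        using sm by (intro summable_on_cmult_left) (simp add: g_def)
      moreover have "\<bar>c \<nu> * monomial \<nu> z - c \<nu> * monomial \<nu> w\<bar> \<le> g \<nu> * (norm (z - w) / r)" for \<nu>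
      proof -
        let ?n = "real (total_degree \<nu>)"
        have "\<bar>c \<nu> * monomial \<nu> z - c \<nu> * monomial \<nu> w\<bar> = \<bar>c \<nu>\<bar> * \<bar>monomial \<nu> z - monomial \<nu> w\<bar>"
          by (simp only: abs_mult flip: right_diff_distrib)
        also have "\<dots> \<le> \<bar>c \<nu>\<bar> * (r ^ total_degree \<nu> * (?n / r) * norm (z - w))"
          using r zr wr by (intro mult_left_mono monomial_diff_le) auto
        also have "\<dots> = (\<bar>c \<nu>\<bar> * r ^ total_degree \<nu> * ?n) * (norm (z - w) / r)" by simp
        also have "\<dots> \<le> g \<nu> * (norm (z - w) / r)"
        proof -
          have "?n \<le> (?n + 1)\<^sup>2" by (simp add: power2_eq_square algebra_simps)
          then show ?thesis unfolding g_def using r by (intro mult_right_mono mult_left_mono) auto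
        qed
        finally show ?thesis .
      qed
      ultimately have "\<bar>f (x + z) - f (x + w)\<bar> \<le> (\<Sum>\<^sub>\<infinity>\<nu>\<in>multi_indices. g \<nu> * (norm (z - w) / r))"
        by (rule abs_has_sum_le_infsum)
      then show "\<bar>f (x + z) - f (x + w)\<bar> \<le> infsum g multi_indices / r * norm (z - w)"
        unfolding infsum_cmult_left' by simp
    qed
  qed
qed

section \<open>Termwise differentiation\<close>

text \<open>A total operator, so that it can be iterated freely; where the function is analytic,
  \<open>has_field_derivative_partial\<close> shows that it is the true derivative.\<close>

definition partial :: "'b \<Rightarrow> ('b::euclidean_space \<Rightarrow> real) \<Rightarrow> 'b \<Rightarrow> real" where
  "partial b f x = deriv (\<lambda>t. f (x + t *\<^sub>R b)) 0"

text \<open>Differentiability is read off from a quadratic remainder because remainder bounds can be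
  summed over the terms of a series.\<close>

lemma has_field_derivative_if_quadratic:
  fixes \<phi> :: "real \<Rightarrow> real"
  assumes "\<delta> > 0" and le: "\<And>t. \<bar>t\<bar> < \<delta> \<Longrightarrow> \<bar>\<phi> t - \<phi> 0 - t * D\<bar> \<le> K * t\<^sup>2"
  shows "(\<phi> has_field_derivative D) (at 0)"
  unfolding DERIV_def
proof (rule Lim_null[THEN iffD2], rule Lim_null_comparison)
  show "\<forall>\<^sub>F t in at 0. norm ((\<phi> (0 + t) - \<phi> 0) / t - D) \<le> K * \<bar>t\<bar>"
    unfolding eventually_at
  proof (intro exI conjI ballI impI)
    show "\<delta> > 0" by fact
    fix t :: real assume "t \<noteq> 0 \<and> dist t 0 < \<delta>"
    then have t: "t \<noteq> 0" "\<bar>t\<bar> < \<delta>" by auto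
    have "norm ((\<phi> (0 + t) - \<phi> 0) / t - D) = \<bar>\<phi> t - \<phi> 0 - t * D\<bar> / \<bar>t\<bar>"
      using t(1) by (simp add: diff_divide_distrib flip: abs_divide)
    also have "\<dots> \<le> K * t\<^sup>2 / \<bar>t\<bar>"
      using le[OF t(2)] by (intro divide_right_mono) auto
    also have "\<dots> = K * \<bar>t\<bar>" using t(1)
      by (simp add: power2_eq_square divide_simps abs_if)
    finally show "norm ((\<phi> (0 + t) - \<phi> 0) / t - D) \<le> K * \<bar>t\<bar>" .
  qed
  have "((\<lambda>t. K * \<bar>t\<bar>) \<longlongrightarrow> K * \<bar>0\<bar>) (at (0::real))" by (intro tendsto_intros)
  then show "((\<lambda>t. K * \<bar>t\<bar>) \<longlongrightarrow> 0) (at (0::real))" by simp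
qed

text \<open>Each term has a Taylor remainder of at most
  \<open>g \<nu> * (t\<^sup>2 / r\<^sup>2)\<close>, uniformly in \<open>z\<close>; summing these
  bounds differentiates the series term by term. Shifting the exponent of \<open>b\<close> by one
  then brings the differentiated series into standard form.\<close>

lemma power_series_at_partial:
  fixes f :: "'b::euclidean_space \<Rightarrow> real"
  assumes f: "power_series_at c f x \<rho>" and b: "b \<in> Basis"
  obtains r where "r > 0"
    "\<forall>z. norm z < r \<longrightarrow> ((\<lambda>t. f (x + z + t *\<^sub>R b)) has_field_derivative partial b f (x + z)) (at 0)"
    "power_series_at (\<lambda>\<nu>. real (\<nu> b + 1) * c (\<nu>(b := \<nu> b + 1))) (partial b f) x r"
proof -
  obtain r where r: "r > 0" "\<forall>z::'b. (\<forall>b\<in>Basis. \<bar>z \<bullet> b\<bar> \<le> r) \<longrightarrow> norm z < \<rho>"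
    and sm: "(\<lambda>\<nu>. \<bar>c \<nu>\<bar> * r ^ total_degree \<nu> * (real (total_degree \<nu>) + 1)\<^sup>2) summable_on multi_indices"
    by (rule power_series_at_summable[OF f])
  define g where "g = (\<lambda>\<nu>::'b\<Rightarrow>nat. \<bar>c \<nu>\<bar> * r ^ total_degree \<nu> * (real (total_degree \<nu>) + 1)\<^sup>2)"
  have g_sm: "g summable_on multi_indices" using sm by (simp add: g_def)
  have g0: "g \<nu> \<ge> 0" for \<nu> using r by (simp add: g_def)
  define q where "q = (\<lambda>\<nu> z. real (\<nu> b) * monomial (\<nu>(b := \<nu> b - 1)) z)"
  define D where "D = (\<lambda>z. \<Sum>\<^sub>\<infinity>\<nu>\<in>multi_indices. c \<nu> * q \<nu> z)"
  have in_cube: "\<bar>z \<bullet> a\<bar> \<le> r" "\<bar>(z + t *\<^sub>R b) \<bullet> a\<bar> \<le> r"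
    if "norm z < r / 2" "\<bar>t\<bar> \<le> r / 2" "a \<in> Basis" for z t a
  proof -
    show "\<bar>z \<bullet> a\<bar> \<le> r" using Basis_le_norm[OF that(3), of z] that r(1) by auto
    have "norm (z + t *\<^sub>R b) \<le> norm z + \<bar>t\<bar>" using norm_triangle_ineq[of z "t *\<^sub>R b"] b by simp
    then show "\<bar>(z + t *\<^sub>R b) \<bullet> a\<bar> \<le> r"
      using Basis_le_norm[OF that(3), of "z + t *\<^sub>R b"] that by linarith
  qed
  have taylor: "\<bar>c \<nu> * (monomial \<nu> (z + t *\<^sub>R b) - monomial \<nu> z - t * q \<nu> z)\<bar> \<le> g \<nu> * (t\<^sup>2 / r\<^sup>2)"
    if "norm z < r / 2" "\<bar>t\<bar> \<le> r / 2" for z t \<nu>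
  proof -
    let ?n = "real (total_degree \<nu>)"
    have "\<bar>monomial \<nu> (z + t *\<^sub>R b) - monomial \<nu> z - t * q \<nu> z\<bar>
        \<le> r ^ total_degree \<nu> * (?n / r)\<^sup>2 * t\<^sup>2"
      unfolding q_def using in_cube[OF that] in_cube(2)[OF that b] b r(1)
      by (intro monomial_taylor_le) (auto simp: inner_add_left)
    also have "\<dots> = (r ^ total_degree \<nu> * ?n\<^sup>2) * (t\<^sup>2 / r\<^sup>2)" by (simp add: power_divide)
    also have "\<dots> \<le> (r ^ total_degree \<nu> * (?n + 1)\<^sup>2) * (t\<^sup>2 / r\<^sup>2)"
      using r(1) by (intro mult_right_mono mult_left_mono power_mono) auto
    finally have "\<bar>c \<nu>\<bar> * \<bar>monomial \<nu> (z + t *\<^sub>R b) - monomial \<nu> z - t * q \<nu> z\<bar>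
        \<le> \<bar>c \<nu>\<bar> * ((r ^ total_degree \<nu> * (?n + 1)\<^sup>2) * (t\<^sup>2 / r\<^sup>2))"
      by (rule mult_left_mono) simp
    then show ?thesis unfolding abs_mult g_def by (simp only: mult.assoc)
  qed
  have ser: "((\<lambda>\<nu>. c \<nu> * monomial \<nu> z) has_sum f (x + z)) multi_indices"
    if "\<And>a. a \<in> Basis \<Longrightarrow> \<bar>z \<bullet> a\<bar> \<le> r" for z
    using f r(2) that by (auto simp: power_series_at_def)
  \<comment> \<open>For one fixed t > 0 the differentiated term is, up to the factor t, the
    difference of two terms of convergent series minus the remainder, so it inherits
    summability.\<close>
  have q_sm: "(\<lambda>\<nu>. c \<nu> * q \<nu> z) summable_on multi_indices" if z: "norm z < r / 2" for z
  proof -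
    define t where "t = r / 2"
    have t: "\<bar>t\<bar> \<le> r / 2" "t > 0" using r(1) by (auto simp: t_def)
    have "(\<lambda>\<nu>. g \<nu> * (t\<^sup>2 / r\<^sup>2)) summable_on multi_indices"
      by (intro summable_on_cmult_left g_sm)
    then have "(\<lambda>\<nu>. norm (c \<nu> * (monomial \<nu> (z + t *\<^sub>R b) - monomial \<nu> z - t * q \<nu> z))) summable_on multi_indices"
      by (rule summable_on_comparison_test) (use taylor[OF z t(1)] in auto)
    then have "(\<lambda>\<nu>. c \<nu> * (monomial \<nu> (z + t *\<^sub>R b) - monomial \<nu> z - t * q \<nu> z)) summable_on multi_indices"
      by (rule summable_on_iff_abs_summable_on_real[THEN iffD2])
    from has_sum_diff_real[OF has_sum_diff_real[OF ser ser] has_sum_infsum[OF this]]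
    have "((\<lambda>\<nu>. c \<nu> * monomial \<nu> (z + t *\<^sub>R b) - c \<nu> * monomial \<nu> z
        - c \<nu> * (monomial \<nu> (z + t *\<^sub>R b) - monomial \<nu> z - t * q \<nu> z)) summable_on multi_indices)"
      using in_cube[OF z t(1)] by (blast intro: has_sum_imp_summable)
    then have "(\<lambda>\<nu>. t * (c \<nu> * q \<nu> z)) summable_on multi_indices"
      by (rule summable_on_cong[THEN iffD1, rotated]) (simp add: algebra_simps)
    from summable_on_cmult_right[OF this, of "1 / t"] t(2) show ?thesis by simp
  qed
  have deriv: "((\<lambda>t. f (x + z + t *\<^sub>R b)) has_field_derivative D z) (at 0)" if z: "norm z < r / 2" for z
  proof (rule has_field_derivative_if_quadratic)
    show "r / 2 > 0" using r by simp
    fix t assume "\<bar>t\<bar> < r / 2"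
    then have t: "\<bar>t\<bar> \<le> r / 2" by simp
    have "((\<lambda>\<nu>. t * (c \<nu> * q \<nu> z)) has_sum t * D z) multi_indices"
      unfolding D_def using q_sm[OF z] by (intro has_sum_cmult_right) simp
    with has_sum_diff_real[OF ser ser] in_cube[OF z t]
    have "((\<lambda>\<nu>. c \<nu> * monomial \<nu> (z + t *\<^sub>R b) - c \<nu> * monomial \<nu> z - t * (c \<nu> * q \<nu> z))
       has_sum f (x + (z + t *\<^sub>R b)) - f (x + z) - t * D z) multi_indices"
      by (intro has_sum_diff_real ser) auto
    moreover have "c \<nu> * monomial \<nu> (z + t *\<^sub>R b) - c \<nu> * monomial \<nu> z - t * (c \<nu> * q \<nu> z)
        = c \<nu> * (monomial \<nu> (z + t *\<^sub>R b) - monomial \<nu> z - t * q \<nu> z)" for \<nu>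
      by (simp add: algebra_simps)
    ultimately have "((\<lambda>\<nu>. c \<nu> * (monomial \<nu> (z + t *\<^sub>R b) - monomial \<nu> z - t * q \<nu> z))
       has_sum f (x + (z + t *\<^sub>R b)) - f (x + z) - t * D z) multi_indices"
      by simp
    moreover have "(\<lambda>\<nu>. g \<nu> * (t\<^sup>2 / r\<^sup>2)) summable_on multi_indices"
      by (intro summable_on_cmult_left g_sm)
    ultimately have "\<bar>f (x + (z + t *\<^sub>R b)) - f (x + z) - t * D z\<bar>
        \<le> (\<Sum>\<^sub>\<infinity>\<nu>\<in>multi_indices. g \<nu> * (t\<^sup>2 / r\<^sup>2))"
      by (rule abs_has_sum_le_infsum) (rule taylor[OF z t])
    then show "\<bar>f (x + z + t *\<^sub>R b) - f (x + z + 0 *\<^sub>R b) - t * D z\<bar>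
        \<le> (infsum g multi_indices / r\<^sup>2) * t\<^sup>2"
      unfolding infsum_cmult_left' by (simp add: add.assoc)
  qed
  have D: "partial b f (x + z) = D z" if "norm z < r / 2" for z
    unfolding partial_def by (rule DERIV_imp_deriv[OF deriv[OF that]])
  show ?thesis
  proof (rule that)
    show "r / 2 > 0" using r by simp
    show "\<forall>z. norm z < r / 2 \<longrightarrow>
        ((\<lambda>t. f (x + z + t *\<^sub>R b)) has_field_derivative partial b f (x + z)) (at 0)"
      using deriv D by simp
    show "power_series_at (\<lambda>\<nu>. real (\<nu> b + 1) * c (\<nu>(b := \<nu> b + 1))) (partial b f) x (r / 2)"
      unfolding power_series_at_def
    proof (intro conjI allI impI)
      show "r / 2 > 0" using r by simp
      fix z :: 'b assume z: "norm z < r / 2"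
      \<comment> \<open>Terms with exponent 0 at \<open>b\<close> have derivative 0; the remaining
        multi-indices are exactly the image of the injective shift \<open>\<phi>\<close>.\<close>
      define \<phi> where "\<phi> = (\<lambda>\<nu>::'b \<Rightarrow> nat. \<nu>(b := \<nu> b + 1))"
      have "inj_on \<phi> multi_indices"
        unfolding \<phi>_def by (rule inj_onI) (metis add_right_cancel fun_upd_idem_iff fun_upd_same fun_upd_upd)
      have im: "\<phi> ` multi_indices = {\<nu> \<in> multi_indices. \<nu> b > 0}"
      proof (intro equalityI subsetI)
        fix \<nu> assume "\<nu> \<in> {\<nu> \<in> multi_indices. \<nu> b > 0}"
        then have "\<nu> = \<phi> (\<nu>(b := \<nu> b - 1))" "\<nu>(b := \<nu> b - 1) \<in> multi_indices"
          by (auto simp: \<phi>_def multi_indices_def)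
        then show "\<nu> \<in> \<phi> ` multi_indices" by blast
      qed (use b in \<open>auto simp: \<phi>_def multi_indices_def\<close>)
      have "((\<lambda>\<nu>. c \<nu> * q \<nu> z) has_sum D z) multi_indices"
        unfolding D_def using q_sm[OF z] by simp
      also have "?this \<longleftrightarrow> ((\<lambda>\<nu>. c \<nu> * q \<nu> z) has_sum D z) (\<phi> ` multi_indices)"
        unfolding im by (rule has_sum_cong_neutral) (auto simp: q_def)
      also have "\<dots> \<longleftrightarrow> (((\<lambda>\<nu>. c \<nu> * q \<nu> z) \<circ> \<phi>) has_sum D z) multi_indices"
        by (rule has_sum_reindex) fact
      finally show "((\<lambda>\<nu>. real (\<nu> b + 1) * c (\<nu>(b := \<nu> b + 1)) * monomial \<nu> z)
          has_sum partial b f (x + z)) multi_indices"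
        unfolding D[OF z] by (simp add: \<phi>_def q_def o_def mult_ac)
    qed
  qed
qed

lemma power_series_at_mono:
  "power_series_at c f x \<rho> \<Longrightarrow> 0 < r \<Longrightarrow> r \<le> \<rho> \<Longrightarrow> power_series_at c f x r"
  by (auto simp: power_series_at_def)

lemma power_series_at_center:
  fixes f :: "'b::euclidean_space \<Rightarrow> real"
  assumes "power_series_at c f x \<rho>"
  shows "c (\<lambda>_. 0) = f x"
proof -
  have "((\<lambda>\<nu>. c \<nu> * monomial \<nu> 0) has_sum f (x + 0)) multi_indices"
    using assms[unfolded power_series_at_def, THEN conjunct1]
      assms[unfolded power_series_at_def, THEN conjunct2, THEN spec[of _ 0]] by simp
  also have "?this \<longleftrightarrow> ((\<lambda>\<nu>. c \<nu> * monomial \<nu> 0) has_sum f (x + 0)) {\<lambda>_. 0}"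
  proof (rule has_sum_cong_neutral)
    fix \<nu> :: "'b \<Rightarrow> nat" assume "\<nu> \<in> multi_indices - {\<lambda>_. 0}"
    then have "\<nu> \<noteq> (\<lambda>_. 0)" "\<forall>b. b \<notin> Basis \<longrightarrow> \<nu> b = 0" by (auto simp: multi_indices_def)
    then obtain b where "b \<in> Basis" "\<nu> b \<noteq> 0" by (metis ext)
    then show "c \<nu> * monomial \<nu> 0 = 0" by (auto simp: monomial_def)
  qed (auto simp: multi_indices_def)
  finally have "((\<lambda>\<nu>. c \<nu> * monomial \<nu> 0) has_sum f x) {\<lambda>_. 0}" by simp
  moreover have "((\<lambda>\<nu>. c \<nu> * monomial \<nu> 0) has_sum c (\<lambda>_. 0)) {\<lambda>_::'b. 0}"
    by (rule has_sum_finiteI) (auto simp: monomial_def)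
  ultimately show ?thesis using has_sum_unique by blast
qed

lemma real_analytic_onE:
  assumes "real_analytic_on f U" "x \<in> U"
  obtains c \<rho> where "ball x \<rho> \<subseteq> U" "power_series_at c f x \<rho>"
  using assms unfolding real_analytic_on_iff by meson

lemma real_analytic_on_partial:
  assumes "real_analytic_on f U" "b \<in> Basis"
  shows "real_analytic_on (partial b f) U"
  unfolding real_analytic_on_iff
proof (intro conjI ballI)
  show "open U" using assms(1) unfolding real_analytic_on_def by simp
  fix x assume x: "x \<in> U"
  obtain c \<rho> where c: "ball x \<rho> \<subseteq> U" "power_series_at c f x \<rho>"
    by (rule real_analytic_onE[OF assms(1) x])
  have "\<rho> > 0" using c by (simp add: power_series_at_def)
  obtain r where "r > 0" "\<forall>z. norm z < r \<longrightarrow>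
      ((\<lambda>t. f (x + z + t *\<^sub>R b)) has_field_derivative partial b f (x + z)) (at 0)"
    "power_series_at (\<lambda>\<nu>. real (\<nu> b + 1) * c (\<nu>(b := \<nu> b + 1))) (partial b f) x r"
    by (rule power_series_at_partial[OF c(2) assms(2)])
  from power_series_at_mono[OF this(3), of "min r \<rho>"] \<open>\<rho> > 0\<close> \<open>r > 0\<close> have
    "power_series_at (\<lambda>\<nu>. real (\<nu> b + 1) * c (\<nu>(b := \<nu> b + 1))) (partial b f) x (min r \<rho>)"
    by simp
  moreover have "ball x (min r \<rho>) \<subseteq> U" using c(1) by auto
  ultimately show "\<exists>c \<rho>. ball x \<rho> \<subseteq> U \<and> power_series_at c (partial b f) x \<rho>"
    by (intro exI[of _ "\<lambda>\<nu>. real (\<nu> b + 1) * c (\<nu>(b := \<nu> b + 1))"] exI[of _ "min r \<rho>"] conjI)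
qed

lemma has_field_derivative_partial:
  assumes "real_analytic_on f U" "b \<in> Basis" "x + t *\<^sub>R b \<in> U"
  shows "((\<lambda>t. f (x + t *\<^sub>R b)) has_field_derivative partial b f (x + t *\<^sub>R b)) (at t)"
proof -
  obtain c \<rho> where c: "ball (x + t *\<^sub>R b) \<rho> \<subseteq> U" "power_series_at c f (x + t *\<^sub>R b) \<rho>"
    by (rule real_analytic_onE[OF assms(1,3)])
  obtain r where "r > 0" and r: "\<forall>z. norm z < r \<longrightarrow>
      ((\<lambda>s. f (x + t *\<^sub>R b + z + s *\<^sub>R b)) has_field_derivative partial b f (x + t *\<^sub>R b + z)) (at 0)"
    using power_series_at_partial[OF c(2) assms(2)] by metis
  from r[rule_format, of 0] \<open>r > 0\<close>
  have "((\<lambda>s. f (x + (s + t) *\<^sub>R b)) has_field_derivative partial b f (x + t *\<^sub>R b)) (at 0)"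
    by (simp add: algebra_simps)
  then show ?thesis
    using DERIV_shift[of "\<lambda>t. f (x + t *\<^sub>R b)" "partial b f (x + t *\<^sub>R b)" 0 t] by simp
qed

lemma real_analytic_on_lipschitz:
  assumes "real_analytic_on f U" "x \<in> U"
  obtains r L where "r > 0" "L \<ge> 0"
    "\<forall>y\<in>ball x r. \<forall>z\<in>ball x r. \<bar>f y - f z\<bar> \<le> L * norm (y - z)"
proof -
  obtain c \<rho> where "ball x \<rho> \<subseteq> U" and c: "power_series_at c f x \<rho>"
    by (rule real_analytic_onE[OF assms])
  obtain r L where r: "r > 0" "L \<ge> 0" and
    L: "\<forall>z w. norm z < r \<and> norm w < r \<longrightarrow> \<bar>f (x + z) - f (x + w)\<bar> \<le> L * norm (z - w)"
    by (rule power_series_at_lipschitz[OF c])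
  show ?thesis
  proof (rule that[OF r])
    show "\<forall>y\<in>ball x r. \<forall>z\<in>ball x r. \<bar>f y - f z\<bar> \<le> L * norm (y - z)"
    proof (intro ballI)
      fix y z assume "y \<in> ball x r" "z \<in> ball x r"
      then have "norm (y - x) < r" "norm (z - x) < r" by (auto simp: dist_norm norm_minus_commute)
      with L[rule_format, of "y - x" "z - x"] show "\<bar>f y - f z\<bar> \<le> L * norm (y - z)" by simp
    qed
  qed
qed

lemma real_analytic_on_imp_continuous_on:
  assumes "real_analytic_on f U"
  shows "continuous_on U f"
proof (rule continuous_at_imp_continuous_on, rule ballI)
  fix x assume x: "x \<in> U"
  obtain r L where r: "r > 0" "L \<ge> 0"
    and L: "\<forall>y\<in>ball x r. \<forall>z\<in>ball x r. \<bar>f y - f z\<bar> \<le> L * norm (y - z)"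
    by (rule real_analytic_on_lipschitz[OF assms x])
  have "(f \<longlongrightarrow> f x) (at x)"
  proof (rule Lim_null[THEN iffD2], rule Lim_null_comparison)
    show "\<forall>\<^sub>F y in at x. norm (f y - f x) \<le> L * norm (y - x)"
      unfolding eventually_at using L r by (intro exI[of _ r]) (auto simp: dist_commute)
    have "((\<lambda>y. L * norm (y - x)) \<longlongrightarrow> L * norm (x - x)) (at x)" by (intro tendsto_intros)
    then show "((\<lambda>y. L * norm (y - x)) \<longlongrightarrow> 0) (at x)" by simp
  qed
  then show "isCont f x" by (simp add: isCont_def)
qed

section \<open>Iterated derivatives and the identity theorem\<close>

definition partials :: "'b set \<Rightarrow> ('b::euclidean_space \<Rightarrow> real) \<Rightarrow> ('b \<Rightarrow> real) set" where
  "partials B f = (\<lambda>bs. foldr partial bs f) ` lists B"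

lemma countable_partials: "finite B \<Longrightarrow> countable (partials B f)"
  unfolding partials_def by (intro countable_image countable_lists countable_finite)

lemma self_in_partials: "f \<in> partials B f"
  unfolding partials_def by (rule image_eqI[of _ _ "[]"]) simp_all

lemma partialsE:
  assumes "h \<in> partials B f"
  obtains bs where "h = foldr partial bs f" "bs \<in> lists B"
  using assms unfolding partials_def by (rule imageE)

text \<open>\<open>foldr\<close> applies the last letter of the list first, so an innermost
  derivative is appended at the end.\<close>

lemma partials_partial_subset:
  assumes "b \<in> B"
  shows "partials B (partial b f) \<subseteq> partials B f"
proof
  fix h assume "h \<in> partials B (partial b f)"
  then obtain bs where bs: "h = foldr partial bs (partial b f)" "bs \<in> lists B"
    by (rule partialsE)
  show "h \<in> partials B f"
    unfolding partials_def
  proof (rule image_eqI)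
    show "h = foldr partial (bs @ [b]) f" using bs(1) by simp
    show "bs @ [b] \<in> lists B" using bs(2) assms by simp
  qed
qed

lemma partials_induct [consumes 1, case_names self partial]:
  assumes "h \<in> partials B f" "P f"
    and "\<And>h b. h \<in> partials B f \<Longrightarrow> P h \<Longrightarrow> b \<in> B \<Longrightarrow> P (partial b h)"
  shows "P h"
proof -
  obtain bs where bs: "h = foldr partial bs f" "bs \<in> lists B"
    using assms(1) by (rule partialsE)
  have "P (foldr partial bs f)" if "bs \<in> lists B" for bs
    using that
  proof induction
    case (Cons b bs)
    then have "foldr partial bs f \<in> partials B f" unfolding partials_def by (intro imageI) simp
    from assms(3)[OF this] Cons show ?case by simp
  qed (simp add: assms(2))
  from this[OF bs(2)] show ?thesis by (simp only: bs(1))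
qed

lemma real_analytic_on_partials:
  assumes "real_analytic_on f U" "B \<subseteq> Basis" "h \<in> partials B f"
  shows "real_analytic_on h U"
  using assms(3)
proof (induction rule: partials_induct)
  case (partial h b)
  then show ?case using assms(2) by (metis real_analytic_on_partial subsetD)
qed (rule assms(1))

text \<open>Induction on the degree: the coefficient of \<open>partial b f\<close> at
  \<open>\<mu>\<close> is \<open>\<nu> b\<close> times that of \<open>f\<close> at
  \<open>\<nu>\<close>, and the constant coefficient is the value at the centre. One function is
  expanded at two centres because the slices to be compared later belong to the same
  function.\<close>

lemma coefficients_eq_if_partials_eq:
  fixes f :: "'b::euclidean_space \<Rightarrow> real"
  assumes "B \<subseteq> Basis" "\<forall>h\<in>partials B f. h x = h x'"
    and "power_series_at c f x \<rho>" "power_series_at c' f x' \<rho>'"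
    and "\<forall>b. b \<notin> B \<longrightarrow> \<nu> b = 0"
  shows "c \<nu> = c' \<nu>"
  using assms(2-)
proof (induction "total_degree \<nu>" arbitrary: f c c' \<rho> \<rho>' \<nu>)
  case 0
  have "\<nu> = (\<lambda>_. 0)"
  proof
    fix b show "\<nu> b = 0"
      using 0(1) 0(5) assms(1) by (cases "b \<in> Basis") (auto simp: total_degree_def)
  qed
  then show ?case
    using power_series_at_center[OF 0(3)] power_series_at_center[OF 0(4)]
      bspec[OF 0(2) self_in_partials] by simp
next
  case (Suc n)
  have "\<exists>b\<in>Basis. \<nu> b \<noteq> 0"
  proof (rule ccontr)
    assume "\<not> (\<exists>b\<in>Basis. \<nu> b \<noteq> 0)"
    then have "total_degree \<nu> = 0" by (simp add: total_degree_def)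
    then show False using Suc.hyps(2) by simp
  qed
  then obtain b where b: "b \<in> Basis" "\<nu> b \<noteq> 0" by blast
  then have "b \<in> B" using Suc.prems(4)[rule_format, of b] by auto
  define \<mu> where "\<mu> = \<nu>(b := \<nu> b - 1)"
  have \<nu>: "\<mu>(b := \<mu> b + 1) = \<nu>" and \<mu>b: "\<mu> b + 1 = \<nu> b" using b(2) by (auto simp: \<mu>_def)
  have "total_degree \<nu> = \<nu> b + sum \<nu> (Basis - {b})" "total_degree \<mu> = \<mu> b + sum \<mu> (Basis - {b})"
    unfolding total_degree_def by (rule sum.remove[OF finite_Basis b(1)])+
  moreover have "sum \<mu> (Basis - {b}) = sum \<nu> (Basis - {b})"
    by (intro sum.cong) (auto simp: \<mu>_def)
  ultimately have "n = total_degree \<mu>" using Suc.hyps(2) \<mu>b by simp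
  obtain r where "r > 0" "\<forall>z. norm z < r \<longrightarrow>
      ((\<lambda>t. f (x + z + t *\<^sub>R b)) has_field_derivative partial b f (x + z)) (at 0)"
    and r: "power_series_at (\<lambda>\<nu>. real (\<nu> b + 1) * c (\<nu>(b := \<nu> b + 1))) (partial b f) x r"
    by (rule power_series_at_partial[OF Suc.prems(2) b(1)])
  obtain r' where "r' > 0" "\<forall>z. norm z < r' \<longrightarrow>
      ((\<lambda>t. f (x' + z + t *\<^sub>R b)) has_field_derivative partial b f (x' + z)) (at 0)"
    and r': "power_series_at (\<lambda>\<nu>. real (\<nu> b + 1) * c' (\<nu>(b := \<nu> b + 1))) (partial b f) x' r'"
    by (rule power_series_at_partial[OF Suc.prems(3) b(1)])
  have "real (\<mu> b + 1) * c (\<mu>(b := \<mu> b + 1)) = real (\<mu> b + 1) * c' (\<mu>(b := \<mu> b + 1))"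
  proof (rule Suc.hyps(1)[OF \<open>n = total_degree \<mu>\<close> _ r r'])
    show "\<forall>h\<in>partials B (partial b f). h x = h x'"
      using Suc.prems(1) partials_partial_subset[OF \<open>b \<in> B\<close>] by blast
    show "\<forall>a. a \<notin> B \<longrightarrow> \<mu> a = 0" using Suc.prems(4) by (auto simp: \<mu>_def)
  qed
  from this[unfolded \<nu>, unfolded \<mu>b] show ?case using b(2) by simp
qed

text \<open>A displacement without components outside \<open>B\<close> annihilates every monomial
  that involves another direction, and the surviving coefficients agree.\<close>

lemma eq_nearby_if_partials_eq:
  fixes f :: "'b::euclidean_space \<Rightarrow> real"
  assumes "B \<subseteq> Basis" "real_analytic_on f U" "x \<in> U" "x' \<in> U" "\<forall>h\<in>partials B f. h x = h x'"
  obtains r where "r > 0"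
    "\<forall>z. norm z < r \<and> (\<forall>b\<in>Basis - B. z \<bullet> b = 0) \<longrightarrow> f (x + z) = f (x' + z)"
proof -
  obtain c \<rho> where "ball x \<rho> \<subseteq> U" and c: "power_series_at c f x \<rho>"
    by (rule real_analytic_onE[OF assms(2,3)])
  obtain c' \<rho>' where "ball x' \<rho>' \<subseteq> U" and c': "power_series_at c' f x' \<rho>'"
    by (rule real_analytic_onE[OF assms(2,4)])
  show ?thesis
  proof (rule that)
    show "min \<rho> \<rho>' > 0" using c c' by (auto simp: power_series_at_def)
    show "\<forall>z. norm z < min \<rho> \<rho>' \<and> (\<forall>b\<in>Basis - B. z \<bullet> b = 0) \<longrightarrow> f (x + z) = f (x' + z)"
    proof (intro allI impI)
      fix z assume z: "norm z < min \<rho> \<rho>' \<and> (\<forall>b\<in>Basis - B. z \<bullet> b = 0)"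
      have "c \<nu> * monomial \<nu> z = c' \<nu> * monomial \<nu> z" if "\<nu> \<in> multi_indices" for \<nu>
      proof (cases "\<forall>b. b \<notin> B \<longrightarrow> \<nu> b = 0")
        case True
        then show ?thesis using coefficients_eq_if_partials_eq[OF assms(1,5) c c'] by simp
      next
        case False
        then obtain b where "b \<notin> B" "\<nu> b \<noteq> 0" by blast
        with that have "b \<in> Basis - B" by (auto simp: multi_indices_def)
        then have "monomial \<nu> z = 0"
          using z \<open>\<nu> b \<noteq> 0\<close> unfolding monomial_def by (intro prod_zero) auto
        then show ?thesis by simp
      qed
      note eq = this
      have "((\<lambda>\<nu>. c' \<nu> * monomial \<nu> z) has_sum f (x' + z)) multi_indices"
        using c' z by (simp add: power_series_at_def)
      then have "((\<lambda>\<nu>. c \<nu> * monomial \<nu> z) has_sum f (x' + z)) multi_indices"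
        by (rule has_sum_cong[THEN iffD2, rotated]) (rule eq)
      moreover have "((\<lambda>\<nu>. c \<nu> * monomial \<nu> z) has_sum f (x + z)) multi_indices"
        using c z by (simp add: power_series_at_def)
      ultimately show "f (x + z) = f (x' + z)" by (rule has_sum_unique[rotated])
    qed
  qed
qed

abbreviation snd_basis :: "('b::euclidean_space \<times> 'c::euclidean_space) set" where
  "snd_basis \<equiv> Pair 0 ` Basis"

lemma snd_basis_subset: "snd_basis \<subseteq> (Basis :: ('b::euclidean_space \<times> 'c::euclidean_space) set)"
  by (auto simp: Basis_prod_def)

text \<open>Identity theorem for the difference of two slices, by a clopen argument on the set
  \<open>S\<close> of points where all derivatives in the second variable agree.\<close>

lemma slices_eq_if_partials_eq:
  fixes f :: "'b::euclidean_space \<times> 'c::euclidean_space \<Rightarrow> real"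
  assumes f: "real_analytic_on f (U \<times> UNIV)" and y: "y \<in> U" "y' \<in> U"
    and w: "\<forall>h\<in>partials snd_basis f. h (y, w) = h (y', w)"
  shows "f (y, w') = f (y', w')"
proof -
  define S where "S = {w. \<forall>h\<in>partials snd_basis f. h (y, w) = h (y', w)}"
  have "closed S"
  proof -
    have "closed {w. h (y, w) = h (y', w)}" if "h \<in> partials snd_basis f" for h
    proof -
      have "real_analytic_on h (U \<times> UNIV)"
        using real_analytic_on_partials[OF f snd_basis_subset that] .
      then have h: "continuous_on (U \<times> UNIV) h" by (rule real_analytic_on_imp_continuous_on)
      have "continuous_on UNIV (\<lambda>w. h (y, w))" "continuous_on UNIV (\<lambda>w. h (y', w))"
        using y by (auto intro!: continuous_on_compose2[OF h] continuous_intros)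
      then show ?thesis by (rule closed_Collect_eq)
    qed
    moreover have "S = (\<Inter>h\<in>partials snd_basis f. {w. h (y, w) = h (y', w)})" by (auto simp: S_def)
    ultimately show ?thesis by auto
  qed
  moreover have "\<exists>r>0. \<forall>w'\<in>ball w r. f (y, w') = f (y', w')" if "w \<in> S" for w
  proof -
    have yw: "(y, w) \<in> U \<times> UNIV" "(y', w) \<in> U \<times> UNIV" using y by auto
    have ps: "\<forall>h\<in>partials snd_basis f. h (y, w) = h (y', w)" using that by (simp add: S_def)
    obtain r where r: "r > 0" "\<forall>z. norm z < r \<and> (\<forall>b\<in>Basis - snd_basis. z \<bullet> b = 0)
        \<longrightarrow> f ((y, w) + z) = f ((y', w) + z)"
      by (rule eq_nearby_if_partials_eq[OF snd_basis_subset f yw ps])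
    have "f (y, w') = f (y', w')" if "w' \<in> ball w r" for w'
    proof -
      have "norm (0 :: 'b, w' - w) < r"
        using that by (simp add: norm_Pair dist_norm norm_minus_commute)
      moreover have "(0 :: 'b, w' - w) \<bullet> b = 0" if "b \<in> Basis - snd_basis" for b
        using that by (auto simp: Basis_prod_def)
      ultimately show ?thesis using r(2)[rule_format, of "(0, w' - w)"] by simp
    qed
    then show ?thesis using r(1) by blast
  qed
  note local = this
  \<comment> \<open>Agreement of all derivatives at \<open>w\<close> gives equal slices on a ball,
    and equality on an open set passes to every derivative, since \<open>deriv\<close> sees only the
    germ.\<close>
  have "open S"
    unfolding open_contains_ball
  proof
    fix w assume "w \<in> S"
    then obtain r where r: "r > 0" "\<forall>w'\<in>ball w r. f (y, w') = f (y', w')" using local by blast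
    have "\<forall>w'\<in>ball w r. h (y, w') = h (y', w')" if "h \<in> partials snd_basis f" for h
      using that
    proof (induction rule: partials_induct)
      case (partial h b)
      then obtain c where b: "b = (0, c)" by auto
      show ?case
      proof
        fix w' assume w': "w' \<in> ball w r"
        have "\<forall>\<^sub>F t in nhds 0. w' + t *\<^sub>R c \<in> ball w r"
        proof -
          have "((\<lambda>t. w' + t *\<^sub>R c) \<longlongrightarrow> w' + 0 *\<^sub>R c) (nhds 0)"
            by (intro tendsto_intros filterlim_ident)
          from topological_tendstoD[OF this open_ball] w' show ?thesis by simp
        qed
        then have "\<forall>\<^sub>F t in nhds 0. h ((y, w') + t *\<^sub>R b) = h ((y', w') + t *\<^sub>R b)"
          by eventually_elim (use partial.IH b in auto)
        then show "partial b h (y, w') = partial b h (y', w')"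
          unfolding partial_def by (rule deriv_cong_ev) simp
      qed
    qed (use r in auto)
    then show "\<exists>e>0. ball w e \<subseteq> S" using r(1) unfolding S_def by blast
  qed
  ultimately have "S = {} \<or> S = UNIV" using connected_UNIV clopen by blast
  then have "w' \<in> S" using w by (auto simp: S_def)
  then show ?thesis using self_in_partials by (auto simp: S_def)
qed

text \<open>Otherwise agreement at \<open>w\<close> would pass from each iterated derivative to all
  of its partial derivatives, hence to all of \<open>partials snd_basis f\<close>, and the two
  slices would coincide.\<close>

lemma exists_transversal_partial:
  fixes f :: "'b::euclidean_space \<times> 'c::euclidean_space \<Rightarrow> real"
  assumes f: "real_analytic_on f (U \<times> UNIV)" and y: "y \<in> U" "y' \<in> U"
    and eq: "f (y, w) = f (y', w)" and ne: "f (y, w') \<noteq> f (y', w')"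
  obtains h b where "h \<in> partials snd_basis f" "b \<in> Basis"
    "h (y, w) = h (y', w)" "partial (0, b) h (y, w) \<noteq> partial (0, b) h (y', w)"
proof -
  have "\<exists>h\<in>partials snd_basis f. \<exists>b\<in>Basis. h (y, w) = h (y', w) \<and>
      partial (0, b) h (y, w) \<noteq> partial (0, b) h (y', w)"
  proof (rule ccontr)
    assume no: "\<not> ?thesis"
    have "h (y, w) = h (y', w)" if "h \<in> partials snd_basis f" for h
      using that by (induction rule: partials_induct) (use eq no in auto)
    then show False using slices_eq_if_partials_eq[OF f y, of w w'] ne by simp
  qed
  then show ?thesis using that by blast
qed

section \<open>Transversal zeros\<close>

text \<open>Only the consequences of a nonvanishing derivative are recorded: on a line in direction
  \<open>v\<close> the zeros move at most Lipschitz with \<open>y\<close>, and continuity makes the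
  local zero set closed. In this form frequency and phase directions can be mixed.\<close>

definition transversal_zero ::
  "('y::euclidean_space \<times> 'v::euclidean_space \<Rightarrow> real) \<Rightarrow> 'v \<Rightarrow> 'y \<Rightarrow> 'v \<Rightarrow> bool" where
  "transversal_zero h v y w \<longleftrightarrow> h (y, w) = 0 \<and>
     (\<exists>r>0. \<exists>L. continuous_on (cball y r \<times> cball w r) h \<and>
       (\<forall>y1\<in>cball y r. \<forall>y2\<in>cball y r. \<forall>a t.
          a \<in> cball w r \<and> a + t *\<^sub>R v \<in> cball w r \<and> h (y1, a) = 0 \<and> h (y2, a + t *\<^sub>R v) = 0
          \<longrightarrow> \<bar>t\<bar> \<le> L * norm (y1 - y2)))"

text \<open>By the mean value theorem on the line, \<open>\<delta>\<close> times |t| is at most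
  |h(y2, a + tv) - h(y2, a)|. As (y1, a) and (y2, a + tv) are zeros, this equals |h(y1, a) - h(y2,
  a)|, which the Lipschitz bound in \<open>y\<close> controls.\<close>

lemma transversal_zeroI:
  fixes y :: "'y::euclidean_space" and w :: "'v::euclidean_space"
  assumes zero: "h (y, w) = 0" and r: "r > 0"
    and h: "continuous_on (cball y r \<times> cball w r) h"
    and lips: "\<And>y1 y2 a. y1 \<in> cball y r \<Longrightarrow> y2 \<in> cball y r \<Longrightarrow> a \<in> cball w r \<Longrightarrow>
      \<bar>h (y1, a) - h (y2, a)\<bar> \<le> L * norm (y1 - y2)"
    and deriv: "\<And>y1 a t. y1 \<in> cball y r \<Longrightarrow> a + t *\<^sub>R v \<in> cball w r \<Longrightarrow>
      ((\<lambda>t. h (y1, a + t *\<^sub>R v)) has_field_derivative h' (y1, a + t *\<^sub>R v)) (at t)"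
    and h': "continuous_on (cball y r \<times> cball w r) h'" and ne: "h' (y, w) \<noteq> 0"
  shows "transversal_zero h v y w"
proof -
  define \<delta> where "\<delta> = \<bar>h' (y, w)\<bar> / 2"
  have "\<delta> > 0" using ne by (simp add: \<delta>_def)
  have "(y, w) \<in> cball y r \<times> cball w r" using r by simp
  with h' \<open>\<delta> > 0\<close> obtain d where d: "d > 0"
    "\<forall>x\<in>cball y r \<times> cball w r. dist x (y, w) < d \<longrightarrow> dist (h' x) (h' (y, w)) < \<delta>"
    unfolding continuous_on_iff by blast
  \<comment> \<open>The distance in the product is at most the sum of two distances of at most
    \<open>\<rho>\<close>; a third of \<open>d\<close> keeps this sum strictly below
    \<open>d\<close>.\<close>
  define \<rho> where "\<rho> = min r (d / 3)"
  have \<rho>: "\<rho> > 0" "\<rho> \<le> r" "2 * \<rho> < d" using d r by (auto simp: \<rho>_def)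
  have sub: "cball y \<rho> \<subseteq> cball y r" "cball w \<rho> \<subseteq> cball w r" using \<rho> by auto
  have big: "\<bar>h' (y1, a)\<bar> \<ge> \<delta>" if "y1 \<in> cball y \<rho>" "a \<in> cball w \<rho>" for y1 a
  proof -
    have "dist (y1, a) (y, w) \<le> dist y1 y + dist a w"
      unfolding dist_Pair_Pair by (rule sqrt_sum_squares_le_sum) auto
    also have "\<dots> \<le> 2 * \<rho>" using that by (simp add: dist_commute)
    also have "\<dots> < d" by fact
    finally have "dist (h' (y1, a)) (h' (y, w)) < \<delta>" using d(2) that sub by blast
    then show ?thesis unfolding dist_real_def \<delta>_def by linarith
  qed
  have main: "\<bar>t\<bar> \<le> (L / \<delta>) * norm (y1 - y2)"
    if y: "y1 \<in> cball y \<rho>" "y2 \<in> cball y \<rho>" and a: "a \<in> cball w \<rho>" "a + t *\<^sub>R v \<in> cball w \<rho>"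
      and z: "h (y1, a) = 0" "h (y2, a + t *\<^sub>R v) = 0" for y1 y2 a t
  proof -
    \<comment> \<open>The segment between the two zeros stays in the ball by convexity;
      \<open>t\<close> may be negative, hence the bounds by \<open>min\<close> and
      \<open>max\<close>.\<close>
    have mid: "a + s *\<^sub>R v \<in> cball w \<rho>" if "min 0 t \<le> s" "s \<le> max 0 t" for s
    proof (cases "t = 0")
      case True
      then show ?thesis using a that by simp
    next
      case False
      have "0 \<le> s / t" "s / t \<le> 1" using False that by (auto simp: divide_simps min_def max_def split: if_splits)
      then have "(1 - s / t) *\<^sub>R a + (s / t) *\<^sub>R (a + t *\<^sub>R v) \<in> cball w \<rho>"
        using a by (intro convexD[OF convex_cball]) auto
      moreover have "(1 - s / t) *\<^sub>R a + (s / t) *\<^sub>R (a + t *\<^sub>R v) = a + s *\<^sub>R v"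
        using False by (simp add: algebra_simps)
      ultimately show ?thesis by simp
    qed
    have "\<bar>t\<bar> * \<delta> \<le> \<bar>h (y2, a + t *\<^sub>R v) - h (y2, a)\<bar>"
    proof (cases "t = 0")
      case False
      define lo where "lo = min 0 t"
      define hi where "hi = max 0 t"
      have "lo < hi" using False by (auto simp: lo_def hi_def)
      moreover have "((\<lambda>t. h (y2, a + t *\<^sub>R v)) has_field_derivative h' (y2, a + s *\<^sub>R v)) (at s)"
        if "lo \<le> s" "s \<le> hi" for s
        using mid[of s] that y sub unfolding lo_def hi_def by (intro deriv) auto
      ultimately obtain s where s: "lo < s" "s < hi"
        "h (y2, a + hi *\<^sub>R v) - h (y2, a + lo *\<^sub>R v) = (hi - lo) * h' (y2, a + s *\<^sub>R v)"
        using MVT2[of lo hi "\<lambda>t. h (y2, a + t *\<^sub>R v)" "\<lambda>s. h' (y2, a + s *\<^sub>R v)"] by auto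
      have t: "\<bar>t\<bar> = \<bar>hi - lo\<bar>" by (auto simp: lo_def hi_def)
      have "\<bar>t\<bar> * \<delta> \<le> \<bar>t\<bar> * \<bar>h' (y2, a + s *\<^sub>R v)\<bar>"
        using mid[of s] s y by (intro mult_left_mono big) (auto simp: lo_def hi_def)
      also have "\<dots> = \<bar>h (y2, a + hi *\<^sub>R v) - h (y2, a + lo *\<^sub>R v)\<bar>"
        unfolding s(3) t by (simp add: abs_mult)
      also have "\<dots> = \<bar>h (y2, a + t *\<^sub>R v) - h (y2, a)\<bar>"
        by (auto simp: lo_def hi_def min_def max_def abs_minus_commute)
      finally show ?thesis .
    qed simp
    also have "\<dots> = \<bar>h (y1, a) - h (y2, a)\<bar>" using z by simp
    also have "\<dots> \<le> L * norm (y1 - y2)" using y a sub by (intro lips) auto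
    finally show ?thesis using \<open>\<delta> > 0\<close> by (simp add: field_simps)
  qed
  have "continuous_on (cball y \<rho> \<times> cball w \<rho>) h"
    using sub by (intro continuous_on_subset[OF h]) auto
  with main \<rho>(1) zero show ?thesis unfolding transversal_zero_def by metis
qed

section \<open>Null sets by counting dimensions\<close>

text \<open>\<open>T\<close> is the image of the set of values of \<open>Y\<close> under the inverse
  of \<open>Y\<close>, which is Lipschitz. Adding a zero coordinate places these values in a
  hyperplane of a space whose dimension is still at most that of the target, and Lipschitz maps
  between such spaces send null sets to null sets.\<close>

lemma negligible_if_inverse_lipschitz:
  fixes Y :: "'n::euclidean_space \<Rightarrow> 'm::euclidean_space"
  assumes dim: "DIM('m) < DIM('n)"
    and le: "\<And>s t. s \<in> T \<Longrightarrow> t \<in> T \<Longrightarrow> norm (s - t) \<le> L * norm (Y s - Y t)"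
  shows "negligible T"
proof -
  have inj: "inj_on Y T"
  proof (rule inj_onI)
    fix s t assume "s \<in> T" "t \<in> T" "Y s = Y t"
    then show "s = t" using le[of s t] by simp
  qed
  define S where "S = (\<lambda>t. (Y t, 0::real)) ` T"
  define F where "F = (\<lambda>p::'m \<times> real. inv_into T Y (fst p))"
  have F: "F (Y t, 0) = t" if "t \<in> T" for t
    using inj that by (simp add: F_def)
  have "negligible S"
  proof (rule negligible_subset)
    have "(0, 1) \<in> (Basis :: ('m \<times> real) set)" by (simp add: Basis_prod_def)
    then show "negligible {p :: 'm \<times> real. p \<bullet> (0, 1) = 0}" by (rule negligible_standard_hyperplane)
    show "S \<subseteq> {p. p \<bullet> (0, 1) = 0}" by (auto simp: S_def)
  qed
  moreover have "\<exists>U B. open U \<and> p \<in> U \<and> (\<forall>q\<in>S \<inter> U. norm (F q - F p) \<le> B * norm (q - p))"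
    if "p \<in> S" for p
  proof (intro exI conjI ballI)
    fix q assume "q \<in> S \<inter> UNIV"
    with that obtain s t where st: "s \<in> T" "t \<in> T" "p = (Y s, 0)" "q = (Y t, 0)"
      by (auto simp: S_def)
    then show "norm (F q - F p) \<le> L * norm (q - p)"
      using le[OF st(2,1)] by (simp add: F norm_Pair)
  qed auto
  ultimately have "negligible (F ` S)"
    using dim by (intro negligible_locally_Lipschitz_image) auto
  moreover have "F ` S = T" using F by (force simp: S_def)
  ultimately show ?thesis by simp
qed

text \<open>
  Fubini along the lines in the directions \<open>v i\<close>: \<open>N\<close> has the same measure as each of its translates.
\<close>

lemma negligible_if_sections_negligible:
  fixes N :: "('v::euclidean_space ^ 'k) set" and v :: "'k \<Rightarrow> 'v"
  assumes N: "N \<in> sets borel"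
    and sect: "\<And>w. negligible {t :: real ^ 'k. (\<chi> i. w $ i + t $ i *\<^sub>R v i) \<in> N}"
  shows "negligible N"
proof -
  define S where "S = (\<lambda>t :: real ^ 'k. \<chi> i. t $ i *\<^sub>R v i)"
  have S: "continuous_on UNIV S" unfolding S_def by (intro continuous_intros)
  have Sm [measurable]: "S \<in> borel_measurable borel" using S by (rule borel_measurable_continuous_onI)
  note N [measurable]
  \<comment> \<open>The space of translation parameters has infinite volume, so integrating the
    constant measure of \<open>N\<close> over it gives 0 only if \<open>N\<close> is null.\<close>
  have "emeasure lborel N * \<infinity> = (\<integral>\<^sup>+t. emeasure lborel N \<partial>(lborel :: (real ^ 'k) measure))"
    by simp
  also have "\<dots> = (\<integral>\<^sup>+t. \<integral>\<^sup>+w. indicator N (S t + w) \<partial>lborel \<partial>lborel)"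
  proof (rule nn_integral_cong)
    fix t
    have "emeasure lborel N = emeasure (distr lborel borel ((+) (S t))) N" 
      by (simp add: lborel_distr_plus)
    also have "\<dots> = (\<integral>\<^sup>+w. indicator N w \<partial>distr lborel borel ((+) (S t)))"
      using N by simp
    also have "\<dots> = (\<integral>\<^sup>+w. indicator N (S t + w) \<partial>lborel)"
      by (subst nn_integral_distr) auto
    finally show "emeasure lborel N = (\<integral>\<^sup>+w. indicator N (S t + w) \<partial>lborel)" .
  qed
  also have "\<dots> = (\<integral>\<^sup>+w. \<integral>\<^sup>+t. indicator N (S t + w) \<partial>lborel \<partial>lborel)"
    by (rule lborel_pair.Fubini'[symmetric]) measurable
  also have "\<dots> = (\<integral>\<^sup>+w. 0 \<partial>(lborel :: ('v ^ 'k) measure))"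
  proof (rule nn_integral_cong)
    fix w :: "'v ^ 'k"
    have eq: "{t. S t + w \<in> N} = {t :: real ^ 'k. (\<chi> i. w $ i + t $ i *\<^sub>R v i) \<in> N}"
    proof -
      have "S t + w = (\<chi> i. w $ i + t $ i *\<^sub>R v i)" for t
        by (simp add: vec_eq_iff S_def add.commute)
      then show ?thesis by simp
    qed
    have m: "{t. S t + w \<in> N} \<in> sets lborel" by measurable
    have "(\<integral>\<^sup>+t. indicator N (S t + w) \<partial>lborel) = (\<integral>\<^sup>+t. indicator {t. S t + w \<in> N} t \<partial>lborel)"
      by (intro nn_integral_cong) (auto simp: indicator_def)
    also have "\<dots> = emeasure lborel {t. S t + w \<in> N}" using m by (rule nn_integral_indicator)
    also have "\<dots> = 0"
      using sect[of w] m unfolding eq[symmetric] negligible_iff_null_sets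
      by (simp add: null_sets_completion_iff null_setsD1)
    finally show "(\<integral>\<^sup>+t. indicator N (S t + w) \<partial>lborel) = 0" .
  qed
  finally have "emeasure lborel N = 0" by (simp add: ennreal_mult_eq_top_iff)
  then have "N \<in> null_sets lborel" using N by (auto simp: null_sets_def)
  then show ?thesis unfolding negligible_iff_null_sets by (rule null_sets_completionI)
qed

lemma compact_vec_cball:
  fixes w :: "'v::euclidean_space ^ 'k"
  shows "compact {u. \<forall>i. u $ i \<in> cball (w $ i) r}"
proof -
  let ?K = "{u. \<forall>i. u $ i \<in> cball (w $ i) r}"
  have "closed ?K"
    unfolding mem_cball by (intro closed_Collect_all closed_Collect_le continuous_intros)
  moreover have "?K \<subseteq> cball w (\<Sum>i\<in>(UNIV :: 'k set). r)"
  proof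
    fix u assume u: "u \<in> ?K"
    have "dist w u \<le> (\<Sum>i\<in>UNIV. dist (w $ i) (u $ i))"
      unfolding dist_vec_def by (rule L2_set_le_sum) auto
    also have "\<dots> \<le> (\<Sum>i\<in>(UNIV :: 'k set). r)" using u by (intro sum_mono) auto
    finally show "u \<in> cball w (\<Sum>i\<in>(UNIV :: 'k set). r)" by simp
  qed
  then have "bounded ?K" by (rule bounded_subset[OF bounded_cball])
  ultimately show ?thesis by (simp add: compact_eq_bounded_closed)
qed

text \<open>In a section along the directions \<open>v i\<close>, each \<open>t\<close> selects a
  witness \<open>Y t\<close>, and transversality bounds every coordinate of \<open>s - t\<close> by
  a multiple of \<open>norm (Y s - Y t)\<close>. So the section falls under
  \<open>negligible_if_inverse_lipschitz\<close>.\<close>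

lemma negligible_local_projection:
  fixes y0 :: "'y::euclidean_space" and w0 :: "'v::euclidean_space ^ 'k"
  assumes dim: "DIM('y) < CARD('k)" and tz: "\<And>i. transversal_zero (h i) (v i) y0 (w0 $ i)"
  obtains r where "r > 0"
    "negligible {w. \<exists>y\<in>cball y0 r. \<forall>i. w $ i \<in> cball (w0 $ i) r \<and> h i (y, w $ i) = 0}"
proof -
  have "\<forall>i. \<exists>r. r > 0 \<and> (\<exists>L. continuous_on (cball y0 r \<times> cball (w0 $ i) r) (h i) \<and>
       (\<forall>y1\<in>cball y0 r. \<forall>y2\<in>cball y0 r. \<forall>a t.
          a \<in> cball (w0 $ i) r \<and> a + t *\<^sub>R v i \<in> cball (w0 $ i) r \<and>
          h i (y1, a) = 0 \<and> h i (y2, a + t *\<^sub>R v i) = 0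
          \<longrightarrow> \<bar>t\<bar> \<le> L * norm (y1 - y2)))"
    using tz unfolding transversal_zero_def by simp
  from choice[OF this] obtain r where r: "\<forall>i. r i > 0 \<and> (\<exists>L. continuous_on (cball y0 (r i) \<times> cball (w0 $ i) (r i)) (h i) \<and>
       (\<forall>y1\<in>cball y0 (r i). \<forall>y2\<in>cball y0 (r i). \<forall>a t.
          a \<in> cball (w0 $ i) (r i) \<and> a + t *\<^sub>R v i \<in> cball (w0 $ i) (r i) \<and>
          h i (y1, a) = 0 \<and> h i (y2, a + t *\<^sub>R v i) = 0
          \<longrightarrow> \<bar>t\<bar> \<le> L * norm (y1 - y2)))" ..
  then have "\<forall>i. \<exists>L. continuous_on (cball y0 (r i) \<times> cball (w0 $ i) (r i)) (h i) \<and>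
       (\<forall>y1\<in>cball y0 (r i). \<forall>y2\<in>cball y0 (r i). \<forall>a t.
          a \<in> cball (w0 $ i) (r i) \<and> a + t *\<^sub>R v i \<in> cball (w0 $ i) (r i) \<and>
          h i (y1, a) = 0 \<and> h i (y2, a + t *\<^sub>R v i) = 0
          \<longrightarrow> \<bar>t\<bar> \<le> L * norm (y1 - y2))" by simp
  from choice[OF this] obtain L where L: "\<forall>i. continuous_on (cball y0 (r i) \<times> cball (w0 $ i) (r i)) (h i) \<and>
       (\<forall>y1\<in>cball y0 (r i). \<forall>y2\<in>cball y0 (r i). \<forall>a t.
          a \<in> cball (w0 $ i) (r i) \<and> a + t *\<^sub>R v i \<in> cball (w0 $ i) (r i) \<and>
          h i (y1, a) = 0 \<and> h i (y2, a + t *\<^sub>R v i) = 0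
          \<longrightarrow> \<bar>t\<bar> \<le> L i * norm (y1 - y2))" ..
  define \<rho> where "\<rho> = Min (range r)"
  have \<rho>: "\<rho> > 0" "\<rho> \<le> r i" for i using r by (auto simp: \<rho>_def)
  have sub: "cball y0 \<rho> \<subseteq> cball y0 (r i)" "cball (w0 $ i) \<rho> \<subseteq> cball (w0 $ i) (r i)" for i
    using \<rho>(2)[of i] by auto
  have h_cont: "continuous_on (cball y0 \<rho> \<times> cball (w0 $ i) \<rho>) (h i)" for i
    using L sub[of i] by (blast intro: continuous_on_subset)
  have est: "\<bar>t\<bar> \<le> \<bar>L i\<bar> * norm (y1 - y2)"
    if "y1 \<in> cball y0 \<rho>" "y2 \<in> cball y0 \<rho>" "a \<in> cball (w0 $ i) \<rho>" "a + t *\<^sub>R v i \<in> cball (w0 $ i) \<rho>"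
      "h i (y1, a) = 0" "h i (y2, a + t *\<^sub>R v i) = 0" for y1 y2 a t i
  proof -
    have "\<bar>t\<bar> \<le> L i * norm (y1 - y2)"
      using L[rule_format, of i] that sub[of i] by blast
    also have "\<dots> \<le> \<bar>L i\<bar> * norm (y1 - y2)" by (intro mult_right_mono) auto
    finally show ?thesis .
  qed
  let ?K = "{u. \<forall>i. u $ i \<in> cball (w0 $ i) \<rho>}"
  let ?N = "{w. \<exists>y\<in>cball y0 \<rho>. \<forall>i. w $ i \<in> cball (w0 $ i) \<rho> \<and> h i (y, w $ i) = 0}"
  \<comment> \<open>The Fubini argument is stated for Borel sets; closed balls make the solution set
    compact, and so is its projection.\<close>
  have "compact ?N"
  proof -
    let ?C = "cball y0 \<rho> \<times> ?K"
    have C: "compact ?C" by (intro compact_Times compact_cball compact_vec_cball)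
    have "closed {p \<in> ?C. h i (fst p, snd p $ i) = 0}" for i
    proof (rule continuous_closed_preimage_constant)
      show "continuous_on ?C (\<lambda>p. h i (fst p, snd p $ i))"
        by (rule continuous_on_compose2[OF h_cont[of i]]) (auto intro!: continuous_intros)
      show "closed ?C" using C by (rule compact_imp_closed)
    qed
    then have "closed (\<Inter>i. {p \<in> ?C. h i (fst p, snd p $ i) = 0})" by (intro closed_INT ballI)
    then have "compact (?C \<inter> (\<Inter>i. {p \<in> ?C. h i (fst p, snd p $ i) = 0}))"
      using C by (intro compact_Int_closed)
    then have "compact (snd ` (?C \<inter> (\<Inter>i. {p \<in> ?C. h i (fst p, snd p $ i) = 0})))"
      by (intro compact_continuous_image continuous_intros)
    also have "snd ` (?C \<inter> (\<Inter>i. {p \<in> ?C. h i (fst p, snd p $ i) = 0})) = ?N"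
      by (force simp: image_iff)
    finally show ?thesis .
  qed
  have "negligible ?N"
  proof (rule negligible_if_sections_negligible)
    show "?N \<in> sets borel" using \<open>compact ?N\<close> by (intro borel_closed compact_imp_closed)
    fix w
    let ?T = "{t :: real ^ 'k. (\<chi> i. w $ i + t $ i *\<^sub>R v i) \<in> ?N}"
    have "\<forall>t\<in>?T. \<exists>y. y \<in> cball y0 \<rho> \<and>
      (\<forall>i. w $ i + t $ i *\<^sub>R v i \<in> cball (w0 $ i) \<rho> \<and> h i (y, w $ i + t $ i *\<^sub>R v i) = 0)"
      by auto
    from bchoice[OF this] obtain Y where Y: "\<forall>t\<in>?T. Y t \<in> cball y0 \<rho> \<and>
      (\<forall>i. w $ i + t $ i *\<^sub>R v i \<in> cball (w0 $ i) \<rho> \<and> h i (Y t, w $ i + t $ i *\<^sub>R v i) = 0)" ..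
    show "negligible ?T"
    proof (rule negligible_if_inverse_lipschitz)
      show "DIM('y) < DIM(real ^ 'k)" using dim by simp
      fix s t assume st: "s \<in> ?T" "t \<in> ?T"
      have "norm (s - t) \<le> (\<Sum>i\<in>UNIV. \<bar>(s - t) $ i\<bar>)" by (rule norm_le_l1_cart)
      also have "\<dots> \<le> (\<Sum>i\<in>UNIV. \<bar>L i\<bar> * norm (Y s - Y t))"
      proof (rule sum_mono)
        fix i
        have eq: "(w $ i + t $ i *\<^sub>R v i) + (s $ i - t $ i) *\<^sub>R v i = w $ i + s $ i *\<^sub>R v i"
          by (simp add: algebra_simps)
        have "\<bar>s $ i - t $ i\<bar> \<le> \<bar>L i\<bar> * norm (Y t - Y s)"
          using bspec[OF Y st(1)] bspec[OF Y st(2)]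
          by (intro est[of _ _ "w $ i + t $ i *\<^sub>R v i"]) (auto simp only: eq)
        then show "\<bar>(s - t) $ i\<bar> \<le> \<bar>L i\<bar> * norm (Y s - Y t)" by (simp add: norm_minus_commute)
      qed
      also have "\<dots> = (\<Sum>i\<in>UNIV. \<bar>L i\<bar>) * norm (Y s - Y t)" by (simp add: sum_distrib_right)
      finally show "norm (s - t) \<le> (\<Sum>i\<in>UNIV. \<bar>L i\<bar>) * norm (Y s - Y t)" .
    qed
  qed
  with \<rho>(1) show ?thesis by (rule that)
qed

text \<open>Different coordinates may draw different pairs from \<open>H\<close>, so
  \<open>B\<close> is cut into countably many pieces, one for each assignment
  \<open>\<sigma>\<close>; on each piece a Lindelof cover globalises the local result. As
  negligibility passes to subsets, \<open>B\<close> may be any set.\<close>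

lemma negligible_transversal_projection:
  fixes B :: "('y::euclidean_space \<times> ('v::euclidean_space ^ 'k)) set"
    and H :: "(('y \<times> 'v \<Rightarrow> real) \<times> 'v) set"
  assumes dim: "DIM('y) < CARD('k)" and H: "countable H"
    and B: "\<And>y w i. (y, w) \<in> B \<Longrightarrow> \<exists>p\<in>H. transversal_zero (fst p) (snd p) y (w $ i)"
  shows "negligible (snd ` B)"
proof -
  define \<Sigma> where "\<Sigma> = (UNIV :: 'k set) \<rightarrow>\<^sub>E H"
  define B' where "B' = (\<lambda>\<sigma>. {q \<in> B. \<forall>i. transversal_zero (fst (\<sigma> i)) (snd (\<sigma> i)) (fst q) (snd q $ i)})"
  have "negligible (snd ` B' \<sigma>)" for \<sigma>
  proof -
    define \<O> where "\<O> = {U. open U \<and> negligible (snd ` (B' \<sigma> \<inter> U))}"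
    have cover: "B' \<sigma> \<subseteq> \<Union>\<O>"
    proof
      fix q assume q: "q \<in> B' \<sigma>"
      obtain y0 w0 where q_eq: "q = (y0, w0)" by (cases q)
      have tz: "transversal_zero (fst (\<sigma> i)) (snd (\<sigma> i)) y0 (w0 $ i)" for i
        using q by (simp add: B'_def q_eq)
      obtain r where r: "r > 0" "negligible {w. \<exists>y\<in>cball y0 r. \<forall>i. w $ i \<in> cball (w0 $ i) r \<and>
          fst (\<sigma> i) (y, w $ i) = 0}"
        by (rule negligible_local_projection[OF dim tz])
      define U where "U = ball y0 r \<times> {w. \<forall>i. w $ i \<in> ball (w0 $ i) r}"
      have "open U"
        unfolding U_def by (intro open_Times open_ball open_vector_box allI)
      moreover have "snd ` (B' \<sigma> \<inter> U) \<subseteq> {w. \<exists>y\<in>cball y0 r. \<forall>i. w $ i \<in> cball (w0 $ i) r \<and>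
          fst (\<sigma> i) (y, w $ i) = 0}"
        by (force simp: B'_def U_def transversal_zero_def less_imp_le)
      ultimately have "U \<in> \<O>"
        using negligible_subset[OF r(2)] by (simp add: \<O>_def)
      moreover have "q \<in> U" using r(1) by (simp add: U_def q_eq)
      ultimately show "q \<in> \<Union>\<O>" by blast
    qed
    obtain \<F> where \<F>: "\<F> \<subseteq> \<O>" "countable \<F>" "\<Union>\<F> = \<Union>\<O>"
      using Lindelof[of \<O>] by (auto simp: \<O>_def)
    have "negligible (\<Union>U\<in>\<F>. snd ` (B' \<sigma> \<inter> U))"
      using \<F>(1,2) by (intro negligible_countable_Union countable_image) (auto simp: \<O>_def)
    moreover have "snd ` B' \<sigma> \<subseteq> (\<Union>U\<in>\<F>. snd ` (B' \<sigma> \<inter> U))"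
    proof
      fix w assume "w \<in> snd ` B' \<sigma>"
      then obtain q where q: "q \<in> B' \<sigma>" "w = snd q" by blast
      then obtain U where "U \<in> \<F>" "q \<in> U" using cover \<F>(3) by blast
      with q show "w \<in> (\<Union>U\<in>\<F>. snd ` (B' \<sigma> \<inter> U))" by blast
    qed
    ultimately show ?thesis by (rule negligible_subset)
  qed
  moreover have "countable \<Sigma>" unfolding \<Sigma>_def using H by (intro countable_PiE) auto
  ultimately have "negligible (\<Union>\<sigma>\<in>\<Sigma>. snd ` B' \<sigma>)"
    by (intro negligible_countable_Union countable_image) auto
  moreover have "snd ` B \<subseteq> (\<Union>\<sigma>\<in>\<Sigma>. snd ` B' \<sigma>)"
  proof
    fix w assume "w \<in> snd ` B"
    then obtain y where yw: "(y, w) \<in> B" by auto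
    have "\<forall>i. \<exists>p. p \<in> H \<and> transversal_zero (fst p) (snd p) y (w $ i)" using B[OF yw] by blast
    from choice[OF this] obtain \<sigma> where
      \<sigma>: "\<forall>i. \<sigma> i \<in> H \<and> transversal_zero (fst (\<sigma> i)) (snd (\<sigma> i)) y (w $ i)" ..
    then have "\<sigma> \<in> \<Sigma>" "(y, w) \<in> B' \<sigma>" using yw by (auto simp: \<Sigma>_def B'_def)
    then show "w \<in> (\<Union>\<sigma>\<in>\<Sigma>. snd ` B' \<sigma>)" by force
  qed
  ultimately show ?thesis by (rule negligible_subset)
qed

section \<open>Characteristic functions in several dimensions\<close>

text \<open>The characteristic function of the weighted law is written with cosines only, the sine
  being a cosine shifted by pi / 2. This fits the induction below, which carries cosine integrals
  with arbitrary phase.\<close>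

lemma (in prob_space) weighted_distr_real_distribution:
  fixes X :: "'a \<Rightarrow> real" and g :: "'a \<Rightarrow> real"
  assumes [measurable]: "X \<in> borel_measurable M" "g \<in> borel_measurable M"
    and g: "\<And>x. 0 \<le> g x" "\<And>x. g x \<le> C" and c: "c = (\<integral>x. g x \<partial>M)" "c \<noteq> 0"
  defines "N \<equiv> distr (density M (\<lambda>x. ennreal (g x / c))) borel X"
  shows "real_distribution N"
    and "char N t = complex_of_real ((\<integral>x. g x * cos (t * X x + 0) \<partial>M) / c)
           + \<i> * complex_of_real ((\<integral>x. g x * cos (t * X x + (- pi / 2)) \<partial>M) / c)"
    and "A \<in> sets borel \<Longrightarrow> measure N A = (\<integral>x. g x * indicator A (X x) \<partial>M) / c"
proof -
  have g_int: "integrable M g"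
    using g by (intro integrable_const_bound[of _ C]) auto
  have "c \<ge> 0" unfolding c(1) using g by (intro Bochner_Integration.integral_nonneg) auto
  then have "c > 0" using c(2) by simp
  have gc: "g x / c \<ge> 0" for x using g \<open>c > 0\<close> by simp
  have "prob_space (density M (\<lambda>x. ennreal (g x / c)))"
  proof (rule prob_spaceI)
    have "emeasure (density M (\<lambda>x. ennreal (g x / c))) (space M) = (\<integral>\<^sup>+x. ennreal (g x / c) \<partial>M)"
      by (subst emeasure_density) (auto intro!: nn_integral_cong)
    also have "\<dots> = ennreal (\<integral>x. g x / c \<partial>M)"
      using g_int gc by (intro nn_integral_eq_integral) auto
    also have "(\<integral>x. g x / c \<partial>M) = 1" using c by simp
    finally show "emeasure (density M (\<lambda>x. ennreal (g x / c))) (space (density M (\<lambda>x. ennreal (g x / c)))) = 1"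
      by simp
  qed
  then show "real_distribution N"
    unfolding N_def by (rule prob_space.real_distribution_distr) simp
  have int: "(\<integral>x. f x \<partial>N) = (\<integral>x. (g x / c) *\<^sub>R f (X x) \<partial>M)"
    if [measurable]: "f \<in> borel_measurable borel" for f :: "real \<Rightarrow> 'z::{banach, second_countable_topology}"
    unfolding N_def using gc by (subst integral_distr) (auto simp: integral_density)
  have bnd: "integrable M (\<lambda>x. (g x / c) *\<^sub>R iexp (t * X x))"
  proof (rule integrable_const_bound)
    show "AE x in M. norm ((g x / c) *\<^sub>R iexp (t * X x)) \<le> C / c"
      using g \<open>c > 0\<close> by (auto simp: divide_right_mono)
  qed simp
  have "char N t = (\<integral>x. (g x / c) *\<^sub>R iexp (t * X x) \<partial>M)"
    unfolding char_def by (rule int) simp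
  also have "\<dots> = complex_of_real (\<integral>x. Re ((g x / c) *\<^sub>R iexp (t * X x)) \<partial>M)
      + \<i> * complex_of_real (\<integral>x. Im ((g x / c) *\<^sub>R iexp (t * X x)) \<partial>M)"
    unfolding integral_Re[OF bnd] integral_Im[OF bnd] by (rule complex_eq)
  also have "(\<lambda>x. Re ((g x / c) *\<^sub>R iexp (t * X x))) = (\<lambda>x. g x * cos (t * X x + 0) / c)"
    by (simp add: fun_eq_iff Re_exp)
  also have "(\<lambda>x. Im ((g x / c) *\<^sub>R iexp (t * X x))) = (\<lambda>x. g x * cos (t * X x + (- pi / 2)) / c)"
    by (simp add: fun_eq_iff Im_exp cos_diff)
  finally show "char N t = complex_of_real ((\<integral>x. g x * cos (t * X x + 0) \<partial>M) / c)
           + \<i> * complex_of_real ((\<integral>x. g x * cos (t * X x + (- pi / 2)) \<partial>M) / c)"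
    by simp
  show "measure N A = (\<integral>x. g x * indicator A (X x) \<partial>M) / c" if "A \<in> sets borel"
  proof -
    interpret N: real_distribution N by fact
    have "measure N A = (\<integral>x. indicator A x \<partial>N)" using that by simp
    also have "\<dots> = (\<integral>x. (g x / c) *\<^sub>R indicator A (X x) \<partial>M)" using that by (intro int) simp
    finally show ?thesis by simp
  qed
qed

text \<open>After normalisation by the common mass \<open>c\<close>, the one-dimensional uniqueness
  theorem applies to the laws of \<open>X\<close>; t = 0 with phase 0 shows that the two masses
  coincide.\<close>

lemma weighted_integral_eqI:
  fixes P Q :: "'b measure" and X g :: "'b \<Rightarrow> real"
  assumes "prob_space P" "prob_space Q"
    and X: "X \<in> borel_measurable P" "X \<in> borel_measurable Q"
    and gm: "g \<in> borel_measurable P" "g \<in> borel_measurable Q"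
    and g: "\<And>x. 0 \<le> g x" "\<And>x. g x \<le> C"
    and eq: "\<And>t \<beta>. (\<integral>x. g x * cos (t * X x + \<beta>) \<partial>P) = (\<integral>x. g x * cos (t * X x + \<beta>) \<partial>Q)"
    and A: "A \<in> sets borel"
  shows "(\<integral>x. g x * indicator A (X x) \<partial>P) = (\<integral>x. g x * indicator A (X x) \<partial>Q)"
proof -
  interpret P: prob_space P by fact
  interpret Q: prob_space Q by fact
  define c where "c = (\<integral>x. g x \<partial>P)"
  have cQ: "c = (\<integral>x. g x \<partial>Q)" using eq[of 0 0] by (simp add: c_def)
  show ?thesis
  proof (cases "c = 0")
    \<comment> \<open>Mass 0 cannot be normalised, but then the nonnegative \<open>g\<close>
      vanishes almost everywhere and both sides are 0.\<close>
    case True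
    have "(\<integral>x. g x * indicator A (X x) \<partial>R) = 0"
      if R: "prob_space R" "X \<in> borel_measurable R" "g \<in> borel_measurable R" "(\<integral>x. g x \<partial>R) = 0" for R
    proof -
      interpret R: prob_space R by fact
      note R(2,3)[measurable] A[measurable]
      have gi: "integrable R g" using g by (intro R.integrable_const_bound[of _ C]) auto
      then have "AE x in R. g x = 0" using R(4) g by (subst (asm) integral_nonneg_eq_0_iff_AE) auto
      then have "(\<integral>x. g x * indicator A (X x) \<partial>R) = (\<integral>x. 0 \<partial>R)" by (intro integral_cong_AE) auto
      then show ?thesis by simp
    qed
    from this[of P] this[of Q] show ?thesis
      using True c_def cQ assms by simp
  next
    case False
    define NP where "NP = distr (density P (\<lambda>x. ennreal (g x / c))) borel X"
    define NQ where "NQ = distr (density Q (\<lambda>x. ennreal (g x / c))) borel X"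
    note p = P.weighted_distr_real_distribution[OF X(1) gm(1) g c_def False, folded NP_def]
    note q = Q.weighted_distr_real_distribution[OF X(2) gm(2) g cQ False, folded NQ_def]
    have "NP = NQ"
    proof (rule Levy_uniqueness[OF p(1) q(1)], rule ext)
      fix t show "char NP t = char NQ t" unfolding p(2) q(2) eq ..
    qed
    with p(3)[OF A] q(3)[OF A] False show ?thesis by simp
  qed
qed

lemma integral_cos_eq_char_fun:
  fixes P :: "'b::euclidean_space measure"
  assumes "prob_space P" and [measurable_cong]: "sets P = sets borel"
  shows "(\<integral>x. cos (\<omega> \<bullet> x + \<alpha>) \<partial>P) = cos \<alpha> * Re (char_fun P \<omega>) - sin \<alpha> * Im (char_fun P \<omega>)"
proof -
  interpret prob_space P by fact
  have i: "integrable P (\<lambda>x. iexp (\<omega> \<bullet> x))"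
    by (rule integrable_const_bound[of _ 1]) auto
  have "Re (char_fun P \<omega>) = (\<integral>x. Re (iexp (\<omega> \<bullet> x)) \<partial>P)"
    "Im (char_fun P \<omega>) = (\<integral>x. Im (iexp (\<omega> \<bullet> x)) \<partial>P)"
    unfolding char_fun_def using i by (simp_all only: integral_Re integral_Im)
  then have ri: "Re (char_fun P \<omega>) = (\<integral>x. cos (\<omega> \<bullet> x) \<partial>P)" "Im (char_fun P \<omega>) = (\<integral>x. sin (\<omega> \<bullet> x) \<partial>P)"
    by (simp_all add: Re_exp Im_exp)
  have c: "integrable P (\<lambda>x. cos (\<omega> \<bullet> x))" and s: "integrable P (\<lambda>x. sin (\<omega> \<bullet> x))"
    by (rule integrable_const_bound[of _ 1]; simp)+
  have "(\<integral>x. cos (\<omega> \<bullet> x + \<alpha>) \<partial>P) = (\<integral>x. cos \<alpha> * cos (\<omega> \<bullet> x) - sin \<alpha> * sin (\<omega> \<bullet> x) \<partial>P)"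
    by (simp add: cos_add mult.commute)
  also have "\<dots> = cos \<alpha> * (\<integral>x. cos (\<omega> \<bullet> x) \<partial>P) - sin \<alpha> * (\<integral>x. sin (\<omega> \<bullet> x) \<partial>P)"
    using c s by simp
  finally show ?thesis by (simp add: ri)
qed

text \<open>Multiplication by the weight stays within sums of cosines with affine argument, to which
  the induction hypothesis below applies.\<close>

lemma cos_product_to_sum:
  "(1 + cos a) * cos (b::real) = cos b + cos (a + b) / 2 + cos (a - b) / 2"
  by (simp add: cos_add cos_diff field_simps)

text \<open>
  The frequencies are traded, one coordinate at a time, for indicators of Borel sets; the weight
  \<open>1 + cos\<close> keeps the measures positive, so that the one-dimensional uniqueness theorem applies.
\<close>

lemma prob_measure_eqI_char_fun:
  fixes P Q :: "'b::euclidean_space measure"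
  assumes P: "prob_space P" and Q: "prob_space Q"
    and sP [measurable_cong]: "sets P = sets borel" and sQ [measurable_cong]: "sets Q = sets borel"
    and eq: "\<And>\<omega>. char_fun P \<omega> = char_fun Q \<omega>"
  shows "P = Q"
proof -
  interpret P: prob_space P by fact
  interpret Q: prob_space Q by fact
  define W :: "('b \<Rightarrow> real set) \<Rightarrow> 'b set \<Rightarrow> 'b \<Rightarrow> real"
    where "W = (\<lambda>A S x. \<Prod>b\<in>S. indicator (A b) (x \<bullet> b))"
  have W01: "0 \<le> W A S x" "W A S x \<le> 1" for A S x
    unfolding W_def by (auto intro!: prod_nonneg prod_le_1)
  \<comment> \<open>All frequencies and phases are carried along, because the product formula calls
    the induction hypothesis at shifted ones.\<close>
  have main: "(\<integral>x. W A S x * cos (\<omega> \<bullet> x + \<alpha>) \<partial>P) = (\<integral>x. W A S x * cos (\<omega> \<bullet> x + \<alpha>) \<partial>Q)"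
    if "finite S" "\<And>b. A b \<in> sets borel" for S A \<omega> \<alpha>
    using that(1)
  proof (induction S arbitrary: \<omega> \<alpha>)
    case empty
    show ?case using integral_cos_eq_char_fun[OF P sP] integral_cos_eq_char_fun[OF Q sQ]
      by (simp add: W_def eq)
  next
    case (insert b S)
    note that(2)[measurable]
    have Wm [measurable]: "W A S \<in> borel_measurable borel" unfolding W_def by measurable
    have int: "integrable R (\<lambda>x. W A S x * cos (\<omega> \<bullet> x + \<alpha>))"
      if "prob_space R" and [measurable_cong]: "sets R = sets borel" for R :: "'b measure" and \<omega> \<alpha>
    proof -
      interpret R: prob_space R by fact
      show ?thesis
      proof (rule R.integrable_const_bound[of _ 1])
        show "AE x in R. norm (W A S x * cos (\<omega> \<bullet> x + \<alpha>)) \<le> 1"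
          unfolding norm_mult using W01 by (intro AE_I2 mult_le_one) auto
      qed simp
    qed
    have int_ind: "integrable R (\<lambda>x. W A S x * indicator (A b) (x \<bullet> b) * cos (\<omega> \<bullet> x + \<alpha>))"
      if "prob_space R" and [measurable_cong]: "sets R = sets borel" for R :: "'b measure" and \<omega> \<alpha>
    proof -
      interpret R: prob_space R by fact
      show ?thesis
      proof (rule R.integrable_const_bound[of _ 1])
        show "AE x in R. norm (W A S x * indicator (A b) (x \<bullet> b) * cos (\<omega> \<bullet> x + \<alpha>)) \<le> 1"
          unfolding norm_mult using W01 by (intro AE_I2 mult_le_one) (auto simp: indicator_def)
      qed simp
    qed
    have step: "(\<integral>x. W A S x * (1 + cos (\<omega> \<bullet> x + \<alpha>)) * indicator (A b) (x \<bullet> b) \<partial>P)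
       = (\<integral>x. W A S x * (1 + cos (\<omega> \<bullet> x + \<alpha>)) * indicator (A b) (x \<bullet> b) \<partial>Q)" for \<omega> \<alpha>
    proof (rule weighted_integral_eqI[OF P Q])
      show "0 \<le> W A S x * (1 + cos (\<omega> \<bullet> x + \<alpha>))" for x
      proof -
        have "- 1 \<le> cos (\<omega> \<bullet> x + \<alpha>)" by simp
        then have "0 \<le> 1 + cos (\<omega> \<bullet> x + \<alpha>)" by linarith
        then show ?thesis using W01 by simp
      qed
      show "W A S x * (1 + cos (\<omega> \<bullet> x + \<alpha>)) \<le> 1 * 2" for x
      proof (rule mult_mono)
        have "- 1 \<le> cos (\<omega> \<bullet> x + \<alpha>)" by simp
        then show "0 \<le> 1 + cos (\<omega> \<bullet> x + \<alpha>)" by linarith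
        show "1 + cos (\<omega> \<bullet> x + \<alpha>) \<le> 2" using cos_le_one[of "\<omega> \<bullet> x + \<alpha>"] by linarith
      qed (use W01 in auto)
      fix t \<beta>
      have expand: "(\<integral>x. W A S x * (1 + cos (\<omega> \<bullet> x + \<alpha>)) * cos (t * (x \<bullet> b) + \<beta>) \<partial>R)
          = (\<integral>x. W A S x * cos ((t *\<^sub>R b) \<bullet> x + \<beta>) \<partial>R)
            + (\<integral>x. W A S x * cos ((\<omega> + t *\<^sub>R b) \<bullet> x + (\<alpha> + \<beta>)) \<partial>R) / 2
            + (\<integral>x. W A S x * cos ((\<omega> - t *\<^sub>R b) \<bullet> x + (\<alpha> - \<beta>)) \<partial>R) / 2"
        if R: "prob_space R" "sets R = sets borel" for R :: "'b measure"
      proof -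
        have "W A S x * (1 + cos (\<omega> \<bullet> x + \<alpha>)) * cos (t * (x \<bullet> b) + \<beta>)
          = W A S x * cos ((t *\<^sub>R b) \<bullet> x + \<beta>) + W A S x * cos ((\<omega> + t *\<^sub>R b) \<bullet> x + (\<alpha> + \<beta>)) / 2
            + W A S x * cos ((\<omega> - t *\<^sub>R b) \<bullet> x + (\<alpha> - \<beta>)) / 2" for x
        proof -
          have "(\<omega> + t *\<^sub>R b) \<bullet> x + (\<alpha> + \<beta>) = (\<omega> \<bullet> x + \<alpha>) + (t * (x \<bullet> b) + \<beta>)"
            "(\<omega> - t *\<^sub>R b) \<bullet> x + (\<alpha> - \<beta>) = (\<omega> \<bullet> x + \<alpha>) - (t * (x \<bullet> b) + \<beta>)"
            "(t *\<^sub>R b) \<bullet> x + \<beta> = t * (x \<bullet> b) + \<beta>"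
            by (simp_all add: inner_add_left inner_diff_left inner_commute[of b x])
          then show ?thesis
            unfolding mult.assoc cos_product_to_sum by (simp only: distrib_left times_divide_eq_right)
        qed
        note eq = this
        have "(\<integral>x. u x + v x / 2 + w x / 2 \<partial>R) = (\<integral>x. u x \<partial>R) + (\<integral>x. v x \<partial>R) / 2 + (\<integral>x. w x \<partial>R) / 2"
          if "integrable R u" "integrable R v" "integrable R w" for u v w :: "'b \<Rightarrow> real"
          using that by simp
        from this[OF int[OF R] int[OF R] int[OF R]] show ?thesis unfolding eq .
      qed
      show "(\<integral>x. W A S x * (1 + cos (\<omega> \<bullet> x + \<alpha>)) * cos (t * (x \<bullet> b) + \<beta>) \<partial>P)
         = (\<integral>x. W A S x * (1 + cos (\<omega> \<bullet> x + \<alpha>)) * cos (t * (x \<bullet> b) + \<beta>) \<partial>Q)"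
        unfolding expand[OF P sP] expand[OF Q sQ] insert.IH ..
    qed (use that(2) in measurable)
    have split: "(\<integral>x. W A S x * (1 + cos (\<omega> \<bullet> x + \<alpha>)) * indicator (A b) (x \<bullet> b) \<partial>R)
        = (\<integral>x. W A S x * indicator (A b) (x \<bullet> b) * cos (0 \<bullet> x + 0) \<partial>R)
          + (\<integral>x. W A S x * indicator (A b) (x \<bullet> b) * cos (\<omega> \<bullet> x + \<alpha>) \<partial>R)"
      if R: "prob_space R" "sets R = sets borel" for R :: "'b measure" and \<omega> \<alpha>
      using int_ind[OF R, of 0 0] int_ind[OF R, of \<omega> \<alpha>]
      by (simp add: algebra_simps flip: Bochner_Integration.integral_add)
    \<comment> \<open>At frequency and phase 0 the weight is the constant 2, which settles the
      integral without cosine; subtracting it from \<open>step\<close> isolates the cosine.\<close>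
    have "2 * (\<integral>x. W A S x * indicator (A b) (x \<bullet> b) * cos (0 \<bullet> x + 0) \<partial>P)
        = 2 * (\<integral>x. W A S x * indicator (A b) (x \<bullet> b) * cos (0 \<bullet> x + 0) \<partial>Q)"
      using step[of 0 0] unfolding split[OF P sP] split[OF Q sQ] by simp
    then have "(\<integral>x. W A S x * indicator (A b) (x \<bullet> b) * cos (\<omega> \<bullet> x + \<alpha>) \<partial>P)
       = (\<integral>x. W A S x * indicator (A b) (x \<bullet> b) * cos (\<omega> \<bullet> x + \<alpha>) \<partial>Q)"
      using step[of \<omega> \<alpha>] unfolding split[OF P sP] split[OF Q sQ] by simp
    moreover have "W A (insert b S) x = W A S x * indicator (A b) (x \<bullet> b)" for x
      using insert.hyps by (simp add: W_def mult.commute)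
    ultimately show ?case by simp
  qed
  \<comment> \<open>With every coordinate turned into an indicator, frequency 0 leaves the measure
    of a box, and boxes form an intersection-stable generator.\<close>
  have boxes: "emeasure P (box l u) = emeasure Q (box l u)" for l u :: 'b
  proof -
    define A where "A = (\<lambda>b. {l \<bullet> b <..< u \<bullet> b})"
    have W: "W A Basis = indicator (box l u)"
      by (rule ext) (auto simp: W_def A_def box_def indicator_def prod_zero_iff)
    have "(\<integral>x. W A Basis x * cos (0 \<bullet> x + 0) \<partial>P) = (\<integral>x. W A Basis x * cos (0 \<bullet> x + 0) \<partial>Q)"
      by (rule main) (auto simp: A_def)
    then have "measure P (box l u) = measure Q (box l u)"
      unfolding W using sP sQ by simp
    then show ?thesis by (simp add: P.emeasure_eq_measure Q.emeasure_eq_measure)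
  qed
  show ?thesis
  proof (rule measure_eqI_generator_eq)
    let ?E = "range (\<lambda>(a, b). box a b :: 'b set)"
    show "Int_stable ?E"
      by (auto simp: Int_stable_def box_Int_box)
    show "?E \<subseteq> Pow UNIV" "sets P = sigma_sets UNIV ?E" "sets Q = sigma_sets UNIV ?E"
      using sP sQ by (simp_all add: borel_eq_box)
    let ?A = "\<lambda>n::nat. box (- (real n *\<^sub>R One)) (real n *\<^sub>R One) :: 'b set"
    show "range ?A \<subseteq> ?E" "(\<Union>i. ?A i) = UNIV"
      unfolding UN_box_eq_UNIV by auto
    show "emeasure P X = emeasure Q X" if "X \<in> ?E" for X using that boxes by auto
    show "emeasure P (?A i) \<noteq> \<infinity>" for i by simp
  qed
qed

section \<open>The joint law of the features\<close>

text \<open>The basis is indexed by pairs of a row and a basis direction, so the product of side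
  lengths regroups by rows. This matches the product that independence yields.\<close>

lemma emeasure_lborel_cbox_vec:
  fixes a b :: "'v::euclidean_space ^ 'n"
  shows "emeasure lborel (cbox a b) = (\<Prod>i\<in>UNIV. emeasure lborel (cbox (a $ i) (b $ i)))"
proof -
  have Basis: "(Basis :: ('v ^ 'n) set) = (\<lambda>(i, u). axis i u) ` (UNIV \<times> Basis)"
    by (auto simp: Basis_vec_def)
  have inj: "inj_on (\<lambda>(i, u). axis i u :: 'v ^ 'n) (UNIV \<times> Basis)"
    by (auto simp: inj_on_def axis_eq_axis)
  have le: "(\<forall>e\<in>Basis. a \<bullet> e \<le> b \<bullet> e) \<longleftrightarrow> (\<forall>i. \<forall>u\<in>Basis. a $ i \<bullet> u \<le> b $ i \<bullet> u)"
    unfolding Basis by (auto simp: inner_axis)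
  have prod: "(\<Prod>e\<in>Basis. (b - a) \<bullet> e) = (\<Prod>i\<in>UNIV. \<Prod>u\<in>Basis. (b $ i - a $ i) \<bullet> u)"
    unfolding Basis prod.reindex[OF inj] by (simp add: prod.cartesian_product inner_axis split_def)
  show ?thesis
  proof (cases "\<forall>i. \<forall>u\<in>Basis. a $ i \<bullet> u \<le> b $ i \<bullet> u")
    case True
    then have "emeasure lborel (cbox a b) = ennreal (\<Prod>i\<in>UNIV. \<Prod>u\<in>Basis. (b $ i - a $ i) \<bullet> u)"
      unfolding emeasure_lborel_cbox_eq le prod by simp
    also have "\<dots> = (\<Prod>i\<in>UNIV. ennreal (\<Prod>u\<in>Basis. (b $ i - a $ i) \<bullet> u))"
      using True by (intro prod_ennreal[symmetric] prod_nonneg) (auto simp: inner_diff_left)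
    also have "\<dots> = (\<Prod>i\<in>UNIV. emeasure lborel (cbox (a $ i) (b $ i)))"
      using True by (intro prod.cong) (auto simp: emeasure_lborel_cbox_eq)
    finally show ?thesis .
  next
    case False
    then obtain i where "\<not> (\<forall>u\<in>Basis. a $ i \<bullet> u \<le> b $ i \<bullet> u)" by blast
    then have "emeasure lborel (cbox (a $ i) (b $ i)) = 0"
      unfolding emeasure_lborel_cbox_eq by (simp only: if_False ennreal_0)
    then have "(\<Prod>i\<in>UNIV. emeasure lborel (cbox (a $ i) (b $ i))) = 0"
      by (intro prod_zero) auto
    moreover have "emeasure lborel (cbox a b) = 0"
      unfolding emeasure_lborel_cbox_eq le using False by (simp only: if_False ennreal_0)
    ultimately show ?thesis by simp
  qed
qed

lemma emeasure_lborel_cbox_Pair: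
  fixes a b :: "'v::euclidean_space \<times> 'w::euclidean_space"
  shows "emeasure lborel (cbox a b)
           = emeasure lborel (cbox (fst a) (fst b)) * emeasure lborel (cbox (snd a) (snd b))"
proof -
  have "cbox a b = cbox (fst a) (fst b) \<times> cbox (snd a) (snd b)"
    using cbox_Pair_eq[of "fst a" "snd a" "fst b" "snd b"] by simp
  then show ?thesis
    unfolding lborel_prod[symmetric] by (simp add: lborel.emeasure_pair_measure_Times)
qed

text \<open>Domination is given on closed boxes, so the null set is covered by boxes: the covering
  lemma provides countably many with disjoint interiors inside an open set \<open>T\<close> of small
  measure, and their volumes add up to at most that of \<open>T\<close>.\<close>

lemma negligible_covered_if_le_lborel:
  fixes \<nu> :: "'b::euclidean_space measure"
  assumes s\<nu>: "sets \<nu> = sets borel"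
    and le: "\<And>a b. emeasure \<nu> (cbox a b) \<le> emeasure lborel (cbox a b)"
    and N: "negligible N" "N \<subseteq> cbox l u" "box l u \<noteq> {}" and e: "e > 0"
  obtains C where "C \<in> sets borel" "N \<subseteq> C" "emeasure \<nu> C \<le> ennreal e"
proof -
  have N0: "N \<in> null_sets lebesgue" using N(1) by (simp add: negligible_iff_null_sets)
  then have "N \<in> sets lebesgue" by auto
  then obtain T where T: "open T" "N \<subseteq> T" "emeasure lebesgue (T - N) < ennreal e"
    using sets_lebesgue_outer_open[OF _ e] by metis
  have "T \<in> sets lebesgue" using T(1) by auto
  then have "emeasure lebesgue T = emeasure lebesgue (T - N)"
    using N0 by (simp add: emeasure_Diff_null_set)
  with T have Te: "emeasure lborel T < ennreal e" by simp
  \<comment> \<open>Each box of the cover lies in the gauge neighbourhood of one of its points in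
    \<open>N\<close>; as \<open>N\<close> lies in \<open>T\<close>, this choice forces the box into
    \<open>T\<close>.\<close>
  define g where "g = (\<lambda>x. if x \<in> T then T else UNIV)"
  have "gauge g" using T(1) by (auto simp: gauge_def g_def)
  from covering_lemma[OF N(2,3) this] obtain \<D> where \<D>: "countable \<D>"
    "\<And>K. K \<in> \<D> \<Longrightarrow> interior K \<noteq> {} \<and> (\<exists>c d. K = cbox c d)"
    "pairwise (\<lambda>A B. interior A \<inter> interior B = {}) \<D>"
    "\<And>K. K \<in> \<D> \<Longrightarrow> \<exists>x\<in>N \<inter> K. K \<subseteq> g x" "N \<subseteq> \<Union>\<D>"
    by metis
  have \<D>T: "K \<subseteq> T" if K: "K \<in> \<D>" for K
  proof -
    obtain x where "x \<in> N \<inter> K" "K \<subseteq> g x" using \<D>(4)[OF K] by blast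
    moreover from this(1) have "x \<in> T" using T(2) by blast
    ultimately show ?thesis by (simp add: g_def)
  qed
  \<comment> \<open>Boxes of the cover may share boundary points, so disjointness is available for
    the interiors only; a box and its interior have equal volume.\<close>
  have int_le: "emeasure \<nu> K \<le> emeasure lborel (interior K)" if K: "K \<in> \<D>" for K
  proof -
    obtain c d where K': "K = cbox c d" using \<D>(2)[OF K] by blast
    have "emeasure lborel (box c d) = emeasure lborel (cbox c d)"
      by (simp add: emeasure_lborel_box_eq emeasure_lborel_cbox_eq)
    then show ?thesis unfolding K' interior_cbox using le by simp
  qed
  \<comment> \<open>Padding with the empty set turns the countable, possibly finite family into a
    sequence.\<close>
  define B where "B = (\<lambda>n. if n \<in> to_nat_on \<D> ` \<D> then from_nat_into \<D> n else {})"
  have B: "B n \<in> insert {} \<D>" for n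
    using \<D>(1) by (auto simp: B_def)
  have UB: "(\<Union>n. B n) = \<Union>\<D>"
  proof
    show "(\<Union>n. B n) \<subseteq> \<Union>\<D>" using B by blast
    show "\<Union>\<D> \<subseteq> (\<Union>n. B n)"
    proof
      fix x assume "x \<in> \<Union>\<D>"
      then obtain K where K: "K \<in> \<D>" "x \<in> K" by blast
      then have "B (to_nat_on \<D> K) = K" using \<D>(1) by (simp add: B_def)
      then show "x \<in> (\<Union>n. B n)" using K(2) by blast
    qed
  qed
  have disj: "disjoint_family (\<lambda>n. interior (B n))"
    unfolding disjoint_family_on_def
  proof (intro ballI impI)
    fix i j :: nat assume ij: "i \<noteq> j"
    show "interior (B i) \<inter> interior (B j) = {}"
    proof (cases "i \<in> to_nat_on \<D> ` \<D> \<and> j \<in> to_nat_on \<D> ` \<D>")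
      case True
      then obtain K K' where "K \<in> \<D>" "K' \<in> \<D>" "i = to_nat_on \<D> K" "j = to_nat_on \<D> K'" by blast
      then have "B i = K" "B j = K'" "K \<noteq> K'" "K \<in> \<D>" "K' \<in> \<D>"
        using \<D>(1) ij by (auto simp: B_def)
      then show ?thesis using \<D>(3) unfolding pairwise_def by blast
    qed (auto simp: B_def)
  qed
  have Bm: "B n \<in> sets borel" for n
  proof -
    have "B n = {} \<or> (\<exists>c d. B n = cbox c d)" using B[of n] \<D>(2) by blast
    then show ?thesis by auto
  qed
  show ?thesis
  proof (rule that)
    show "\<Union>\<D> \<in> sets borel" unfolding UB[symmetric] using Bm by auto
    show "N \<subseteq> \<Union>\<D>" by fact
    have "emeasure \<nu> (\<Union>\<D>) = emeasure \<nu> (\<Union>n. B n)" by (simp add: UB)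
    also have "\<dots> \<le> (\<Sum>n. emeasure \<nu> (B n))"
      using Bm s\<nu> by (intro emeasure_subadditive_countably) auto
    also have "\<dots> \<le> (\<Sum>n. emeasure lborel (interior (B n)))"
    proof (rule suminf_le)
      show "emeasure \<nu> (B n) \<le> emeasure lborel (interior (B n))" for n
        using B[of n] int_le by auto
    qed auto
    also have "\<dots> = emeasure lborel (\<Union>n. interior (B n))"
      using disj by (intro suminf_emeasure) auto
    also have "\<dots> \<le> emeasure lborel T"
      using B \<D>T T(1) interior_subset by (intro emeasure_mono) (auto, blast)
    also have "\<dots> \<le> ennreal e" using Te by simp
    finally show "emeasure \<nu> (\<Union>\<D>) \<le> ennreal e" .
  qed
qed

text \<open>The covering lemma asks for bounded sets, whence the cut into boxes; on each box the
  covers of measure at most 1 / (n + 1) intersect in a null set.\<close>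

lemma AE_not_in_negligible_if_le_lborel:
  fixes \<nu> :: "'b::euclidean_space measure"
  assumes s\<nu>: "sets \<nu> = sets borel"
    and le: "\<And>a b. emeasure \<nu> (cbox a b) \<le> emeasure lborel (cbox a b)"
    and N: "negligible N"
  shows "AE x in \<nu>. x \<notin> N"
proof -
  have bounded: "AE x in \<nu>. x \<notin> N \<inter> cbox l u" if box: "box l u \<noteq> {}" for l u
  proof -
    have neg: "negligible (N \<inter> cbox l u)" using N by (rule negligible_subset) simp
    have "\<exists>C. C \<in> sets borel \<and> N \<inter> cbox l u \<subseteq> C \<and> emeasure \<nu> C \<le> ennreal (1 / (real n + 1))" for n :: nat
    proof -
      obtain C where "C \<in> sets borel" "N \<inter> cbox l u \<subseteq> C" "emeasure \<nu> C \<le> ennreal (1 / (real n + 1))"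
        by (rule negligible_covered_if_le_lborel[OF s\<nu> le neg _ box, of "1 / (real n + 1)"]) auto
      then show ?thesis by blast
    qed
    then have "\<forall>n::nat. \<exists>C. C \<in> sets borel \<and> N \<inter> cbox l u \<subseteq> C \<and> emeasure \<nu> C \<le> ennreal (1 / (real n + 1))"
      by blast
    from choice[OF this] obtain C where
      C: "\<forall>n::nat. C n \<in> sets borel \<and> N \<inter> cbox l u \<subseteq> C n \<and> emeasure \<nu> (C n) \<le> ennreal (1 / (real n + 1))" ..
    have m: "(\<Inter>n. C n) \<in> sets \<nu>" unfolding s\<nu> using C by (intro sets.countable_INT) auto
    have "emeasure \<nu> (\<Inter>n. C n) \<le> ennreal (1 / (real n + 1))" for n :: nat
    proof -
      have "emeasure \<nu> (\<Inter>n. C n) \<le> emeasure \<nu> (C n)" using C s\<nu> by (intro emeasure_mono) auto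
      also have "\<dots> \<le> ennreal (1 / (real n + 1))" using C by blast
      finally show ?thesis .
    qed
    moreover have "(\<lambda>n. ennreal (1 / (real n + 1))) \<longlonglongrightarrow> ennreal 0"
      using LIMSEQ_inverse_real_of_nat by (intro tendsto_ennrealI) (simp add: inverse_eq_divide add.commute)
    ultimately have "emeasure \<nu> (\<Inter>n. C n) \<le> ennreal 0"
      by (intro LIMSEQ_le_const[of "\<lambda>n. ennreal (1 / (real n + 1))"]) auto
    then have "(\<Inter>n. C n) \<in> null_sets \<nu>" using m by auto
    moreover have "N \<inter> cbox l u \<subseteq> (\<Inter>n. C n)" using C by blast
    ultimately show ?thesis by (intro AE_I'[of "\<Inter>n. C n"]) auto
  qed
  \<comment> \<open>Half side n + 1 rather than n keeps the open box nonempty at n = 0.\<close>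
  define A where "A = (\<lambda>n::nat. cbox (- ((real n + 1) *\<^sub>R One)) ((real n + 1) *\<^sub>R One) :: 'b set)"
  have "\<forall>n. AE x in \<nu>. x \<notin> N \<inter> A n"
    unfolding A_def by (intro allI bounded) (simp add: box_eq_empty not_le)
  then have "AE x in \<nu>. \<forall>n. x \<notin> N \<inter> A n" by (rule AE_all_countable[THEN iffD2])
  moreover have "\<exists>n. x \<in> A n" for x :: 'b
  proof -
    have "x \<in> (\<Union>n::nat. box (- (real n *\<^sub>R One)) (real n *\<^sub>R One))" by (simp only: UN_box_eq_UNIV UNIV_I)
    then obtain n :: nat where n: "\<forall>b\<in>Basis. - real n < x \<bullet> b \<and> x \<bullet> b < real n" by (auto simp: box_def)
    have "x \<in> A n"
      unfolding A_def mem_box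
    proof
      fix b :: 'b assume "b \<in> Basis"
      with n show "- ((real n + 1) *\<^sub>R One) \<bullet> b \<le> x \<bullet> b \<and> x \<bullet> b \<le> (real n + 1) *\<^sub>R One \<bullet> b"
        by fastforce
    qed
    then show ?thesis ..
  qed
  ultimately show ?thesis by (auto elim!: eventually_mono)
qed

text \<open>The density is bounded by its value at the origin, a nonpositive power of 2 pi, hence by
  1.\<close>

lemma std_normal_vector_le_lborel:
  assumes X: "std_normal_vector M X" and A: "A \<in> sets borel"
  shows "emeasure M (X -` A \<inter> space M) \<le> emeasure lborel A"
proof -
  let ?f = "\<lambda>x::real^'d. ennreal ((2 * pi) powr (- real CARD('d) / 2) * exp (- (norm x)\<^sup>2 / 2))"
  have le1: "?f x \<le> 1" for x
  proof -
    have "(2 * pi) powr (- real CARD('d) / 2) \<le> (2 * pi) powr 0"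
      using pi_gt3 by (intro powr_mono) auto
    also have "\<dots> = 1" using pi_gt_zero by simp
    finally have "(2 * pi) powr (- real CARD('d) / 2) * exp (- (norm x)\<^sup>2 / 2) \<le> 1 * 1"
      by (intro mult_mono) auto
    then show ?thesis by (simp add: ennreal_le_1)
  qed
  have "emeasure M (X -` A \<inter> space M) = (\<integral>\<^sup>+x. ?f x * indicator A x \<partial>lborel)"
    using X A unfolding std_normal_vector_def by (intro distributed_emeasure) auto
  also have "\<dots> \<le> (\<integral>\<^sup>+x. indicator A x \<partial>lborel)"
    using le1 by (intro nn_integral_mono) (auto simp: indicator_def)
  also have "\<dots> = emeasure lborel A" using A by simp
  finally show ?thesis .
qed

text \<open>The density is at most 1 / (2 pi), hence at most 1.\<close>

lemma uniform_le_lborel: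
  assumes X: "X \<in> borel_measurable M" "distr M lborel X = uniform_measure lborel {- pi<..<pi}"
    and A: "A \<in> sets borel"
  shows "emeasure M (X -` A \<inter> space M) \<le> emeasure lborel A"
proof -
  have "emeasure M (X -` A \<inter> space M) = emeasure (distr M lborel X) A"
    using X(1) A by (subst emeasure_distr) auto
  also have "\<dots> = emeasure lborel ({- pi<..<pi} \<inter> A) / emeasure lborel {- pi<..<pi}"
    unfolding X(2) using A by (intro emeasure_uniform_measure) auto
  also have "\<dots> \<le> emeasure lborel ({- pi<..<pi} \<inter> A) * 1"
    unfolding divide_ennreal_def
  proof (rule mult_left_mono)
    have "inverse (emeasure lborel {- pi<..<pi}) = inverse (ennreal (2 * pi))"
      using pi_gt_zero by simp
    also have "\<dots> = ennreal (inverse (2 * pi))" using pi_gt_zero by (intro inverse_ennreal) simp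
    also have "\<dots> \<le> 1" using pi_gt3 by (simp add: ennreal_le_1 divide_simps)
    finally show "inverse (emeasure lborel {- pi<..<pi}) \<le> 1" .
  qed simp
  also have "\<dots> \<le> emeasure lborel A" using A by (auto intro: emeasure_mono)
  finally show ?thesis .
qed

lemma borel_measurable_vec_lambda:
  fixes f :: "'n::finite \<Rightarrow> 'a \<Rightarrow> 'v::euclidean_space"
  assumes "\<And>i. f i \<in> borel_measurable M"
  shows "(\<lambda>z. \<chi> i. f i z) \<in> borel_measurable M"
proof (rule borel_measurable_euclidean_space[THEN iffD2], rule ballI)
  fix e :: "'v ^ 'n" assume "e \<in> Basis"
  then obtain i u where e: "e = axis i u" by (auto simp: Basis_vec_def)
  show "(\<lambda>z. (\<chi> i. f i z) \<bullet> e) \<in> borel_measurable M"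
    unfolding e inner_axis using assms[of i] by simp
qed

lemma mem_cbox_vec:
  fixes x :: "'v::euclidean_space ^ 'n"
  shows "x \<in> cbox a b \<longleftrightarrow> (\<forall>i. x $ i \<in> cbox (a $ i) (b $ i))"
  by (auto simp: mem_box Basis_vec_def inner_axis)

lemma mem_cbox_prod:
  fixes x :: "'v::euclidean_space \<times> 'w::euclidean_space"
  shows "x \<in> cbox a b \<longleftrightarrow> fst x \<in> cbox (fst a) (fst b) \<and> snd x \<in> cbox (snd a) (snd b)"
  by (simp add: mem_box Basis_prod_def ball_Un inner_prod_def)

lemma prod_mono_ennreal:
  fixes f g :: "'i \<Rightarrow> ennreal"
  assumes "\<And>i. i \<in> A \<Longrightarrow> f i \<le> g i"
  shows "prod f A \<le> prod g A"
  using assms by (induction A rule: infinite_finite_induct) (auto intro!: mult_mono)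

text \<open>The components are independent with densities at most 1, so the probability of a box is
  at most its volume, which is what the covering argument asks for.\<close>

lemma AE_features_not_in_negligible:
  fixes \<Omega> :: "'k::finite \<Rightarrow> 'l::finite \<Rightarrow> 'a \<Rightarrow> real^'d" and \<alpha> :: "'k \<Rightarrow> 'a \<Rightarrow> real"
  assumes prob: "prob_space M" and feat: "random_feature_parameters M s e e' \<Omega> \<alpha>"
    and N: "negligible (N :: (((real^'d^'l) \<times> real) ^ 'k) set)"
  shows "AE z in M. (\<chi> i. ((\<chi> j. \<Omega> i j z), \<alpha> i z)) \<notin> N"
proof -
  interpret prob_space M by fact
  define Z where "Z = (\<lambda>z. (\<chi> i. ((\<chi> j. \<Omega> i j z), \<alpha> i z)) :: ((real^'d^'l) \<times> real) ^ 'k)"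
  have \<Omega>: "std_normal_vector M (\<Omega> i j)" for i j
    using feat by (simp add: random_feature_parameters_def)
  have \<alpha>: "\<alpha> i \<in> borel_measurable M" "distr M lborel (\<alpha> i) = uniform_measure lborel {- pi<..<pi}" for i
    using feat by (simp_all add: random_feature_parameters_def)
  have \<Omega>m: "\<Omega> i j \<in> borel_measurable M" for i j
    using distributed_measurable[OF \<Omega>[of i j, unfolded std_normal_vector_def]] by simp
  have Zm: "Z \<in> borel_measurable M"
    unfolding Z_def
    by (intro borel_measurable_vec_lambda borel_measurable_Pair \<Omega>m \<alpha>(1))
  define F where "F = case_sum (\<lambda>(i, j). generated_sets M (\<Omega> i j))
    (case_sum (\<lambda>i. generated_sets M (\<alpha> i)) (\<lambda>_::unit. noise_sets M s e e'))"
  have indep: "indep_sets F UNIV"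
    using feat by (simp add: random_feature_parameters_def F_def)
  have le: "emeasure (distr M borel Z) (cbox a b) \<le> emeasure lborel (cbox a b)" for a b
  proof -
    define A where "A = case_sum (\<lambda>(i, j). \<Omega> i j -` cbox (fst (a $ i) $ j) (fst (b $ i) $ j) \<inter> space M)
      (case_sum (\<lambda>i. \<alpha> i -` cbox (snd (a $ i)) (snd (b $ i)) \<inter> space M) (\<lambda>_::unit. space M))"
    \<comment> \<open>\<open>J\<close> collects the indices of frequencies and phases; independence
      over this finite subfamily factorises the probability of the box.\<close>
    define J :: "(('k \<times> 'l) + ('k + unit)) set" where "J = range Inl \<union> Inr ` range Inl"
    have J: "finite J" "J \<noteq> {}" by (auto simp: J_def)
    have cb: "x \<in> cbox a b \<longleftrightarrow> (\<forall>i. (\<forall>j. fst (x $ i) $ j \<in> cbox (fst (a $ i) $ j) (fst (b $ i) $ j))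
        \<and> snd (x $ i) \<in> cbox (snd (a $ i)) (snd (b $ i)))" for x
      by (simp add: mem_cbox_vec mem_cbox_prod)
    have J_iff: "z \<in> (\<Inter>p\<in>J. A p) \<longleftrightarrow> (\<forall>i j. z \<in> A (Inl (i, j))) \<and> (\<forall>i. z \<in> A (Inr (Inl i)))" for z
      by (auto simp: J_def)
    have "Z -` cbox a b \<inter> space M = (\<Inter>p\<in>J. A p)"
      by (rule set_eqI, unfold J_iff) (auto simp: cb Z_def A_def)
    moreover have "prob (\<Inter>p\<in>J. A p) = (\<Prod>p\<in>J. prob (A p))"
    proof -
      have gen: "X -` C \<inter> space M \<in> generated_sets M X" if "C \<in> sets borel"
        for X :: "'a \<Rightarrow> 'z::topological_space" and C
        using that unfolding generated_sets_def by blast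
      have "A \<in> Pi J F"
        by (auto simp: J_def A_def F_def intro!: gen)
      with indep J show ?thesis unfolding indep_sets_def by blast
    qed
    ultimately have "emeasure (distr M borel Z) (cbox a b) = (\<Prod>p\<in>J. emeasure M (A p))"
      using Zm by (simp add: emeasure_distr emeasure_eq_measure prod_ennreal)
    also have "\<dots> = (\<Prod>p\<in>UNIV. emeasure M (A (Inl p))) * (\<Prod>i\<in>UNIV. emeasure M (A (Inr (Inl i))))"
      unfolding J_def by (subst prod.union_disjoint) (auto simp: prod.reindex inj_on_def)
    also have "\<dots> \<le> (\<Prod>p\<in>UNIV. emeasure lborel (cbox (fst (a $ fst p) $ snd p) (fst (b $ fst p) $ snd p)))
       * (\<Prod>i\<in>UNIV. emeasure lborel (cbox (snd (a $ i)) (snd (b $ i))))"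
      by (intro mult_mono prod_mono_ennreal)
        (auto simp: A_def intro!: std_normal_vector_le_lborel[OF \<Omega>] uniform_le_lborel[OF \<alpha>])
    also have "\<dots> = emeasure lborel (cbox a b)"
      by (simp add: emeasure_lborel_cbox_vec emeasure_lborel_cbox_Pair prod.distrib
          UNIV_Times_UNIV[symmetric] prod.cartesian_product' split_def del: UNIV_Times_UNIV)
    finally show ?thesis .
  qed
  have "AE x in distr M borel Z. x \<notin> N"
    using le N by (intro AE_not_in_negligible_if_le_lborel) auto
  from AE_distrD[OF Zm this] show ?thesis by (simp add: Z_def)
qed

text \<open>Coordinates commute with the integral because the features are bounded; the sum over
  rows is the inner product with the stacked frequencies.\<close>

lemma fourier_features_integral_nth:
  fixes P :: "(real^'d^'l) measure" and w :: "'k::finite \<Rightarrow> 'l::finite \<Rightarrow> real^'d"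
  assumes "prob_space P" and sP [measurable_cong]: "sets P = sets borel"
  shows "(\<integral>x. fourier_features w a x \<partial>P) $ i
    = cos (a i) * Re (char_fun P (\<chi> j. w i j)) - sin (a i) * Im (char_fun P (\<chi> j. w i j))"
proof -
  interpret prob_space P by fact
  have eq: "fourier_features w a x $ i = cos ((\<chi> j. w i j) \<bullet> x + a i)" for x i
    by (simp add: fourier_features_def inner_vec_def)
  have m: "(\<lambda>x. fourier_features w a x) \<in> borel_measurable P"
  proof -
    have "(\<lambda>x. \<chi> i. cos ((\<chi> j. w i j) \<bullet> x + a i)) \<in> borel_measurable P"
      by (intro borel_measurable_vec_lambda) measurable
    also have "(\<lambda>x. \<chi> i. cos ((\<chi> j. w i j) \<bullet> x + a i)) = fourier_features w a"
      by (simp add: fun_eq_iff vec_eq_iff eq)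
    finally show ?thesis .
  qed
  have "integrable P (\<lambda>x. fourier_features w a x)"
  proof (rule integrable_const_bound[OF _ m])
    have "norm (fourier_features w a x) \<le> real CARD('k)" for x
    proof -
      have "norm (fourier_features w a x) \<le> (\<Sum>i\<in>UNIV. \<bar>fourier_features w a x $ i\<bar>)"
        by (rule norm_le_l1_cart)
      also have "\<dots> \<le> (\<Sum>i\<in>(UNIV::'k set). 1)" by (intro sum_mono) (simp add: eq)
      finally show ?thesis by simp
    qed
    then show "AE x in P. norm (fourier_features w a x) \<le> real CARD('k)" by simp
  qed
  from integral_bounded_linear[OF bounded_linear_vec_nth this, of i]
  have "(\<integral>x. fourier_features w a x \<partial>P) $ i = (\<integral>x. cos ((\<chi> j. w i j) \<bullet> x + a i) \<partial>P)"
    by (simp add: eq)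
  also have "\<dots> = cos (a i) * Re (char_fun P (\<chi> j. w i j)) - sin (a i) * Im (char_fun P (\<chi> j. w i j))"
    by (rule integral_cos_eq_char_fun) fact+
  finally show ?thesis .
qed

section \<open>Injectivity of random features\<close>

text \<open>
  A point \<open>(y, w)\<close> consists of a pair \<open>y\<close> of model parameters and of \<open>w = (\<omega>, \<alpha>)\<close>, a frequency and
  a phase; \<open>slice_diff\<close> ignores the phase.
\<close>

definition slice_diff ::
  "('b \<times> 'c \<Rightarrow> real) \<Rightarrow> ('b \<times> 'b) \<times> ('c \<times> real) \<Rightarrow> real" where
  "slice_diff h = (\<lambda>(y, w). h (fst y, fst w) - h (snd y, fst w))"

text \<open>The two halves of \<open>y\<close> see \<open>h\<close> near two different points, each
  with its own local constant, and the constants add up.\<close>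

lemma slice_diff_lipschitz:
  fixes h :: "'b::euclidean_space \<times> 'c::euclidean_space \<Rightarrow> real" and y :: "'b \<times> 'b" and w :: "'c \<times> real"
  assumes h: "real_analytic_on h (U \<times> UNIV)" and y: "fst y \<in> U" "snd y \<in> U"
  obtains r L where "r > 0"
    "\<forall>y1\<in>cball y r. \<forall>y2\<in>cball y r. \<forall>a\<in>cball w r.
       \<bar>slice_diff h (y1, a) - slice_diff h (y2, a)\<bar> \<le> L * norm (y1 - y2)"
proof -
  have mem: "(fst y, fst w) \<in> U \<times> UNIV" "(snd y, fst w) \<in> U \<times> UNIV" using y by auto
  obtain r1 L1 where 1: "r1 > 0" "L1 \<ge> 0"
    "\<forall>p\<in>ball (fst y, fst w) r1. \<forall>q\<in>ball (fst y, fst w) r1. \<bar>h p - h q\<bar> \<le> L1 * norm (p - q)"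
    by (rule real_analytic_on_lipschitz[OF h mem(1)])
  obtain r2 L2 where 2: "r2 > 0" "L2 \<ge> 0"
    "\<forall>p\<in>ball (snd y, fst w) r2. \<forall>q\<in>ball (snd y, fst w) r2. \<bar>h p - h q\<bar> \<le> L2 * norm (p - q)"
    by (rule real_analytic_on_lipschitz[OF h mem(2)])
  \<comment> \<open>Division by 3 leaves room for the product distance, which is bounded by the sum
    of two distances of at most \<open>r\<close>.\<close>
  define r where "r = min r1 r2 / 3"
  have r: "r > 0" "2 * r < r1" "2 * r < r2" using 1(1) 2(1) by (auto simp: r_def)
  show ?thesis
  proof (rule that[OF r(1)], intro ballI)
    fix y1 y2 a assume y1: "y1 \<in> cball y r" and y2: "y2 \<in> cball y r" and a: "a \<in> cball w r"
    have near: "dist (u, v) (u', v') < s"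
      if "dist u u' \<le> r" "dist v v' \<le> r" "2 * r < s" for u u' :: 'b and v v' :: 'c and s
    proof -
      have "dist (u, v) (u', v') \<le> dist u u' + dist v v'"
        unfolding dist_Pair_Pair by (rule sqrt_sum_squares_le_sum) auto
      then show ?thesis using that by simp
    qed
    have d: "dist (fst y) (fst y') \<le> r" "dist (snd y) (snd y') \<le> r" if "y' \<in> cball y r" for y'
      using that dist_fst_le[of y y'] dist_snd_le[of y y'] by auto
    have da: "dist (fst w) (fst a) \<le> r" using a dist_fst_le[of w a] by auto
    have "\<bar>h (fst y1, fst a) - h (fst y2, fst a)\<bar> \<le> L1 * norm ((fst y1, fst a) - (fst y2, fst a))"
      using 1(3)[rule_format, of "(fst y1, fst a)" "(fst y2, fst a)"]
        near[OF d(1)[OF y1] da r(2)] near[OF d(1)[OF y2] da r(2)] by (simp only: mem_ball)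
    also have "norm ((fst y1, fst a) - (fst y2, fst a)) \<le> norm (y1 - y2)"
      using norm_fst_le[of "fst (y1 - y2)" "snd (y1 - y2)"] by (simp add: minus_prod_def)
    finally have A: "\<bar>h (fst y1, fst a) - h (fst y2, fst a)\<bar> \<le> L1 * norm (y1 - y2)"
      using 1(2) by (simp add: mult_left_mono)
    have "\<bar>h (snd y1, fst a) - h (snd y2, fst a)\<bar> \<le> L2 * norm ((snd y1, fst a) - (snd y2, fst a))"
      using 2(3)[rule_format, of "(snd y1, fst a)" "(snd y2, fst a)"]
        near[OF d(2)[OF y1] da r(3)] near[OF d(2)[OF y2] da r(3)] by (simp only: mem_ball)
    also have "norm ((snd y1, fst a) - (snd y2, fst a)) \<le> norm (y1 - y2)"
      using norm_snd_le[of "snd (y1 - y2)" "fst (y1 - y2)"] by (simp add: minus_prod_def)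
    finally have "\<bar>h (snd y1, fst a) - h (snd y2, fst a)\<bar> \<le> L2 * norm (y1 - y2)"
      using 2(2) by (simp add: mult_left_mono)
    with A show "\<bar>slice_diff h (y1, a) - slice_diff h (y2, a)\<bar> \<le> (L1 + L2) * norm (y1 - y2)"
      by (simp add: slice_diff_def distrib_right)
  qed
qed

lemma slice_diff_continuous:
  fixes h :: "'b::euclidean_space \<times> 'c::euclidean_space \<Rightarrow> real"
  assumes "real_analytic_on h (U \<times> UNIV)"
  shows "continuous_on ((U \<times> U) \<times> UNIV) (slice_diff h)"
proof -
  have h: "continuous_on (U \<times> UNIV) h" using assms by (rule real_analytic_on_imp_continuous_on)
  show ?thesis
    unfolding slice_diff_def split_def
    by (intro continuous_on_diff continuous_on_compose2[OF h] continuous_intros) auto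
qed

text \<open>The direction (b, 0) moves the frequency and fixes the phase, and differentiation
  commutes with taking the slice difference.\<close>

lemma transversal_zero_slice_diff:
  fixes h :: "'b::euclidean_space \<times> 'c::euclidean_space \<Rightarrow> real" and y :: "'b \<times> 'b" and w :: "'c \<times> real"
  assumes h: "real_analytic_on h (U \<times> UNIV)" and U: "open U" "fst y \<in> U" "snd y \<in> U"
    and b: "b \<in> Basis" and zero: "slice_diff h (y, w) = 0"
    and ne: "slice_diff (partial (0, b) h) (y, w) \<noteq> 0"
  shows "transversal_zero (slice_diff h) (b, 0) y w"
proof -
  have b': "(0, b) \<in> (Basis :: ('b \<times> 'c) set)" using b by (simp add: Basis_prod_def)
  have ph: "real_analytic_on (partial (0, b) h) (U \<times> UNIV)" by (rule real_analytic_on_partial[OF h b'])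
  have "open (U \<times> U)" "y \<in> U \<times> U" using U by (auto simp: open_Times mem_Times_iff)
  then obtain r0 where r0: "r0 > 0" "cball y r0 \<subseteq> U \<times> U" using open_contains_cball by blast
  obtain r1 L where r1: "r1 > 0" "\<forall>y1\<in>cball y r1. \<forall>y2\<in>cball y r1. \<forall>a\<in>cball w r1.
       \<bar>slice_diff h (y1, a) - slice_diff h (y2, a)\<bar> \<le> L * norm (y1 - y2)"
    by (rule slice_diff_lipschitz[OF h U(2,3)])
  define r where "r = min r0 r1"
  have r: "r > 0" "cball y r \<subseteq> U \<times> U" using r0 r1(1) by (auto simp: r_def)
  show ?thesis
  proof (rule transversal_zeroI[where h = "slice_diff h" and r = r and L = L
        and h' = "slice_diff (partial (0, b) h)"])
    show "slice_diff h (y, w) = 0" "r > 0" "slice_diff (partial (0, b) h) (y, w) \<noteq> 0" by fact+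
    show "continuous_on (cball y r \<times> cball w r) (slice_diff h)"
      using r(2) by (intro continuous_on_subset[OF slice_diff_continuous[OF h]]) auto
    show "continuous_on (cball y r \<times> cball w r) (slice_diff (partial (0, b) h))"
      using r(2) by (intro continuous_on_subset[OF slice_diff_continuous[OF ph]]) auto
    show "\<bar>slice_diff h (y1, a) - slice_diff h (y2, a)\<bar> \<le> L * norm (y1 - y2)"
      if "y1 \<in> cball y r" "y2 \<in> cball y r" "a \<in> cball w r" for y1 y2 a
      using r1(2) that by (auto simp: r_def)
    fix y1 and a :: "'c \<times> real" and t assume y1: "y1 \<in> cball y r"
    then have y1U: "fst y1 \<in> U" "snd y1 \<in> U" using r(2) by auto
    have d: "((\<lambda>t. h (u, fst a + t *\<^sub>R b)) has_field_derivative partial (0, b) h (u, fst a + t *\<^sub>R b)) (at t)"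
      if "u \<in> U" for u
      using has_field_derivative_partial[OF h b', of "(u, fst a)" t] that by simp
    show "((\<lambda>t. slice_diff h (y1, a + t *\<^sub>R (b, 0))) has_field_derivative
        slice_diff (partial (0, b) h) (y1, a + t *\<^sub>R (b, 0))) (at t)"
      using DERIV_diff[OF d[OF y1U(1)] d[OF y1U(2)]] by (simp add: slice_diff_def)
  qed
qed

text \<open>The function g of the overview, with the real part of the rotated difference written
  out.\<close>

definition phase_diff ::
  "('b \<times> 'c \<Rightarrow> complex) \<Rightarrow> ('b \<times> 'b) \<times> ('c \<times> real) \<Rightarrow> real" where
  "phase_diff F = (\<lambda>(y, w). cos (snd w) * slice_diff (\<lambda>x. Re (F x)) (y, w)
     - sin (snd w) * slice_diff (\<lambda>x. Im (F x)) (y, w))"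

text \<open>In the phase direction, value and derivative are Re and -Im of one rotated complex
  number; they cannot both vanish while the slices differ at this frequency.\<close>

lemma transversal_zero_phase_diff:
  fixes F :: "'b::euclidean_space \<times> 'c::euclidean_space \<Rightarrow> complex"
  assumes F: "complex_real_analytic_on F (U \<times> UNIV)" and U: "open U" "fst y \<in> U" "snd y \<in> U"
    and zero: "phase_diff F (y, w) = 0" and ne: "F (fst y, fst w) \<noteq> F (snd y, fst w)"
  shows "transversal_zero (phase_diff F) (0, 1) y w"
proof -
  define R where "R = (\<lambda>x. Re (F x))"
  define I where "I = (\<lambda>x. Im (F x))"
  have R: "real_analytic_on R (U \<times> UNIV)" and I: "real_analytic_on I (U \<times> UNIV)"
    using F by (simp_all add: complex_real_analytic_on_def R_def I_def)
  have phase: "phase_diff F p = cos (snd (snd p)) * slice_diff R p - sin (snd (snd p)) * slice_diff I p" for p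
    by (simp add: phase_diff_def R_def I_def split_def)
  define h' where "h' = (\<lambda>p :: ('b \<times> 'b) \<times> ('c \<times> real).
    - sin (snd (snd p)) * slice_diff R p - cos (snd (snd p)) * slice_diff I p)"
  have "open (U \<times> U)" "y \<in> U \<times> U" using U by (auto simp: open_Times mem_Times_iff)
  then obtain r0 where r0: "r0 > 0" "cball y r0 \<subseteq> U \<times> U" using open_contains_cball by blast
  obtain r1 L1 where r1: "r1 > 0" "\<forall>y1\<in>cball y r1. \<forall>y2\<in>cball y r1. \<forall>a\<in>cball w r1.
       \<bar>slice_diff R (y1, a) - slice_diff R (y2, a)\<bar> \<le> L1 * norm (y1 - y2)"
    by (rule slice_diff_lipschitz[OF R U(2,3)])
  obtain r2 L2 where r2: "r2 > 0" "\<forall>y1\<in>cball y r2. \<forall>y2\<in>cball y r2. \<forall>a\<in>cball w r2.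
       \<bar>slice_diff I (y1, a) - slice_diff I (y2, a)\<bar> \<le> L2 * norm (y1 - y2)"
    by (rule slice_diff_lipschitz[OF I U(2,3)])
  define r where "r = min r0 (min r1 r2)"
  have r: "r > 0" "cball y r \<subseteq> U \<times> U" using r0 r1(1) r2(1) by (auto simp: r_def)
  have cont: "continuous_on (cball y r \<times> cball w r) (slice_diff R)"
    "continuous_on (cball y r \<times> cball w r) (slice_diff I)"
    using r(2) by (auto intro!: continuous_on_subset[OF slice_diff_continuous[OF R]]
      continuous_on_subset[OF slice_diff_continuous[OF I]])
  show ?thesis
  proof (rule transversal_zeroI[where h = "phase_diff F" and r = r and L = "L1 + L2" and h' = h'])
    show "phase_diff F (y, w) = 0" "r > 0" by fact+
    show "continuous_on (cball y r \<times> cball w r) (phase_diff F)"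
      unfolding phase by (intro continuous_intros cont)
    show "continuous_on (cball y r \<times> cball w r) h'"
      unfolding h'_def by (intro continuous_intros cont)
    show "\<bar>phase_diff F (y1, a) - phase_diff F (y2, a)\<bar> \<le> (L1 + L2) * norm (y1 - y2)"
      if "y1 \<in> cball y r" "y2 \<in> cball y r" "a \<in> cball w r" for y1 y2 a
    proof -
      let ?dR = "slice_diff R (y1, a) - slice_diff R (y2, a)"
      let ?dI = "slice_diff I (y1, a) - slice_diff I (y2, a)"
      have "phase_diff F (y1, a) - phase_diff F (y2, a) = cos (snd a) * ?dR - sin (snd a) * ?dI"
        by (simp add: phase algebra_simps)
      also have "\<bar>\<dots>\<bar> \<le> \<bar>cos (snd a)\<bar> * \<bar>?dR\<bar> + \<bar>sin (snd a)\<bar> * \<bar>?dI\<bar>"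
        unfolding abs_mult[symmetric] by (rule abs_triangle_ineq4)
      also have "\<dots> \<le> 1 * \<bar>?dR\<bar> + 1 * \<bar>?dI\<bar>"
        by (intro add_mono mult_right_mono) auto
      also have "\<dots> \<le> L1 * norm (y1 - y2) + L2 * norm (y1 - y2)"
        using r1(2) r2(2) that by (auto simp: r_def intro!: add_mono)
      finally show ?thesis by (simp add: distrib_right)
    qed
    fix y1 a t
    show "((\<lambda>t. phase_diff F (y1, a + t *\<^sub>R (0, 1))) has_field_derivative h' (y1, a + t *\<^sub>R (0, 1))) (at t)"
      unfolding phase h'_def by (auto simp: slice_diff_def intro!: derivative_eq_intros)
    show "h' (y, w) \<noteq> 0"
    proof
      assume h0: "h' (y, w) = 0"
      let ?c = "cos (snd w)" and ?s = "sin (snd w)"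
      let ?R = "slice_diff R (y, w)" and ?I = "slice_diff I (y, w)"
      have eqs: "?c * ?R - ?s * ?I = 0" "- ?s * ?R - ?c * ?I = 0"
        using zero h0 by (simp_all add: phase h'_def)
      \<comment> \<open>Undoing the rotation expresses both components of the difference through
        value and derivative.\<close>
      have "(c\<^sup>2 + s\<^sup>2) * x = c * (c * x - s * z) - s * (- s * x - c * z)"
        "(c\<^sup>2 + s\<^sup>2) * z = - s * (c * x - s * z) - c * (- s * x - c * z)" for c s x z :: real
        by (simp_all add: algebra_simps power2_eq_square)
      note this[where c = ?c and s = ?s and x = ?R and z = ?I]
      then have "?R = 0" "?I = 0" unfolding eqs by (simp_all add: sin_cos_squared_add2)
      then show False using ne by (simp add: slice_diff_def R_def I_def complex_eq_iff)
    qed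
  qed
qed

text \<open>Pairs live in dimension 2p, one less than the number of features: this is the inequality
  that \<open>negligible_transversal_projection\<close> demands.\<close>

lemma negligible_non_injective_features:
  fixes F :: "(real^'p) \<times> 'c::euclidean_space \<Rightarrow> complex" and T :: "(real^'p) set"
  assumes k: "CARD('k) = 2 * CARD('p) + 1"
    and F: "complex_real_analytic_on F (U \<times> UNIV)" and U: "open U" "T \<subseteq> U"
    and sep: "\<And>t t'. t \<in> T \<Longrightarrow> t' \<in> T \<Longrightarrow> t \<noteq> t' \<Longrightarrow> \<exists>w. F (t, w) \<noteq> F (t', w)"
  shows "negligible {w :: ('c \<times> real) ^ 'k. \<exists>t\<in>T. \<exists>t'\<in>T. t \<noteq> t' \<and>
           (\<forall>i. phase_diff F ((t, t'), w $ i) = 0)}" (is "negligible ?N")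
proof -
  define R where "R = (\<lambda>x. Re (F x))"
  define I where "I = (\<lambda>x. Im (F x))"
  have R: "real_analytic_on R (U \<times> UNIV)" and I: "real_analytic_on I (U \<times> UNIV)"
    using F by (simp_all add: complex_real_analytic_on_def R_def I_def)
  \<comment> \<open>The phase direction serves where the slices differ at the drawn frequency;
    iterated derivatives of the real and imaginary parts, paired with a frequency direction, serve
    where they coincide.\<close>
  define H :: "((((real^'p) \<times> (real^'p)) \<times> ('c \<times> real) \<Rightarrow> real) \<times> ('c \<times> real)) set"
    where "H = insert (phase_diff F, (0, 1))
    ((\<lambda>(h, b). (slice_diff h, (b, 0))) ` ((partials snd_basis R \<union> partials snd_basis I) \<times> Basis))"
  have "countable H"
    unfolding H_def
    by (intro countable_insert countable_image countable_SIGMA countable_Un countable_partials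
        finite_imageI finite_Basis countable_finite)
  define B where "B = {(y, w :: ('c \<times> real) ^ 'k). fst y \<in> T \<and> snd y \<in> T \<and> fst y \<noteq> snd y \<and>
    (\<forall>i. phase_diff F (y, w $ i) = 0)}"
  have "\<exists>p\<in>H. transversal_zero (fst p) (snd p) y (w $ i)" if yw: "(y, w) \<in> B" for y w i
  proof -
    have y: "fst y \<in> U" "snd y \<in> U" "fst y \<in> T" "snd y \<in> T" "fst y \<noteq> snd y"
      and z: "phase_diff F (y, w $ i) = 0" using yw U(2) by (auto simp: B_def)
    let ?w = "fst (w $ i)"
    show ?thesis
    proof (cases "F (fst y, ?w) = F (snd y, ?w)")
      case False
      from transversal_zero_phase_diff[OF F U(1) y(1,2) z False] show ?thesis by (auto simp: H_def)
    next
      case True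
      obtain v where v: "F (fst y, v) \<noteq> F (snd y, v)" using sep y by blast
      \<comment> \<open>Slices that differ at \<open>v\<close> do so in the real or in the imaginary
        part; \<open>f\<close> is a part that differs.\<close>
      define f where "f = (if R (fst y, v) \<noteq> R (snd y, v) then R else I)"
      have f: "real_analytic_on f (U \<times> UNIV)" using R I by (simp add: f_def)
      have eq: "f (fst y, ?w) = f (snd y, ?w)" using True by (simp add: f_def R_def I_def)
      have ne: "f (fst y, v) \<noteq> f (snd y, v)" using v by (auto simp: f_def R_def I_def complex_eq_iff)
      obtain h b where h: "h \<in> partials snd_basis f" "b \<in> Basis"
        "h (fst y, ?w) = h (snd y, ?w)" "partial (0, b) h (fst y, ?w) \<noteq> partial (0, b) h (snd y, ?w)"
        by (rule exists_transversal_partial[OF f y(1,2) eq ne])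
      have "transversal_zero (slice_diff h) (b, 0) y (w $ i)"
        using real_analytic_on_partials[OF f snd_basis_subset h(1)] U(1) y(1,2) h(2)
        by (rule transversal_zero_slice_diff) (use h(3,4) in \<open>simp_all add: slice_diff_def\<close>)
      moreover have "(slice_diff h, (b, 0)) \<in> H"
      proof -
        have "(h, b) \<in> (partials snd_basis R \<union> partials snd_basis I) \<times> Basis"
          using h(1,2) by (auto simp: f_def split: if_splits)
        then show ?thesis unfolding H_def by force
      qed
      ultimately show ?thesis by force
    qed
  qed
  then have "negligible (snd ` B)"
    using k \<open>countable H\<close> by (intro negligible_transversal_projection[of H]) auto
  moreover have "?N \<subseteq> snd ` B"
    by (force simp: B_def)
  ultimately show ?thesis by (rule negligible_subset)
qed

theorem theorem1:
  fixes M :: "'a measure"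
    and s m :: nat
    and pos :: "'l::finite \<Rightarrow> nat"
    and \<Theta> :: "(real^'p) set" and \<theta>\<^sub>0 :: "real^'p"
    and e :: "int \<Rightarrow> 'a \<Rightarrow> real" and e' :: "nat \<Rightarrow> int \<Rightarrow> 'a \<Rightarrow> real"
    and G :: "nat \<Rightarrow> nat \<Rightarrow> nat \<Rightarrow> (nat \<Rightarrow> real) \<Rightarrow> real^'p \<Rightarrow> real^'d"
      \<comment> \<open>\<open>G n r t\<close> is the mapping with subscript \<open>t\<close> and superscript \<open>(n, r)\<close>\<close>
    and Glim :: "nat \<Rightarrow> nat \<Rightarrow> (nat \<Rightarrow> real) \<Rightarrow> real^'p \<Rightarrow> real^'d"
      \<comment> \<open>\<open>Glim r t\<close> is the mapping with subscript \<open>t\<close> and superscript \<open>(r)\<close>\<close>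
    and Xobs :: "nat \<Rightarrow> nat \<Rightarrow> 'a \<Rightarrow> real^'d"
    and Xsim :: "nat \<Rightarrow> nat \<Rightarrow> nat \<Rightarrow> real^'p \<Rightarrow> 'a \<Rightarrow> real^'d"
    and \<Omega> :: "'k::finite \<Rightarrow> 'l \<Rightarrow> 'a \<Rightarrow> real^'d" and \<alpha> :: "'k \<Rightarrow> 'a \<Rightarrow> real"
    and P :: "real^'p \<Rightarrow> (real^'d^'l) measure"
  assumes prob: "prob_space M"
    and s: "s \<ge> 1"
    and window: "CARD('l) = m + 1" "bij_betw pos UNIV {1..m+1}"
    and k: "CARD('k) = 2 * CARD('p) + 1"
    and \<theta>\<^sub>0: "\<theta>\<^sub>0 \<in> \<Theta>"
    and noise: "iid_sequence M e" "iid_copies M s e e'"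
    and features: "random_feature_parameters M s e e' \<Omega> \<alpha>"
    and G: "\<forall>n\<ge>1. \<forall>t\<ge>1. \<forall>r\<in>{0..s}.
        (\<lambda>(x, \<theta>). G n r t x \<theta>) \<in> seq_space \<Otimes>\<^sub>M restrict_space borel \<Theta> \<rightarrow>\<^sub>M borel \<and>
        (\<forall>\<theta>\<in>\<Theta>. stationary_ergodic M (\<lambda>j \<omega>. G n r t (past e j \<omega>) \<theta>))"
    and A1: "\<forall>n\<ge>1. \<forall>t\<in>{1..n}. \<forall>\<omega>\<in>space M.
        Xobs n t \<omega> = G n 0 t (past (e' 0) (int t) \<omega>) \<theta>\<^sub>0 \<and>
        (\<forall>r\<in>{1..s}. \<forall>\<theta>\<in>\<Theta>. Xsim n r t \<theta> \<omega> = G n r t (past (e' r) (int t) \<omega>) \<theta>)"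
    and A2_maps: "\<forall>t\<ge>1. \<forall>r\<in>{0..s}.
        (\<lambda>(x, \<theta>). Glim r t x \<theta>) \<in> seq_space \<Otimes>\<^sub>M restrict_space borel \<Theta> \<rightarrow>\<^sub>M borel \<and>
        (\<forall>\<theta>\<in>\<Theta>. stationary_ergodic M (\<lambda>j \<omega>. Glim r t (past e j \<omega>) \<theta>))"
    and A2_conv: "\<forall>r\<in>{0..s}. \<exists>q>2.
        (\<lambda>n. SUP \<theta>\<in>\<Theta>.
           (\<Sum>t\<in>{1..n}. Lq_norm M q (\<lambda>\<omega>. G n r t (past e 0 \<omega>) \<theta> - Glim r t (past e 0 \<omega>) \<theta>))
             / of_nat n)
        \<longlonglongrightarrow> 0"
    and A3_prob: "\<forall>\<theta>\<in>\<Theta>. prob_space (P \<theta>) \<and> sets (P \<theta>) = sets borel"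
    and A3_conv: "\<forall>\<phi> :: real^'d^'l \<Rightarrow> real. continuous_on UNIV \<phi> \<and> bounded (range \<phi>) \<longrightarrow>
        (\<lambda>n. SUP \<theta>\<in>\<Theta>. MAX r\<in>{0..s}.
           \<bar>(\<integral>x. \<phi> x \<partial>average_law m (window_law M e m pos (Glim r) \<theta>) n) - (\<integral>x. \<phi> x \<partial>P \<theta>)\<bar>)
        \<longlonglongrightarrow> 0"
    and A4_i: "compact \<Theta>" "semialgebraic \<Theta>" "interior \<Theta> \<noteq> {}"
    and A4_ii: "inj_on P \<Theta>"
    and A4_iii: "\<exists>U F. open U \<and> \<Theta> \<subseteq> U \<and> complex_real_analytic_on F (U \<times> UNIV) \<and>
        (\<forall>\<theta>\<in>\<Theta>. \<forall>\<omega>. F (\<theta>, \<omega>) = char_fun (P \<theta>) \<omega>)"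
  shows "AE z in M. inj_on (\<lambda>\<theta>. \<integral>x. fourier_features (\<lambda>i j. \<Omega> i j z) (\<lambda>i. \<alpha> i z) x \<partial>P \<theta>) \<Theta>"
proof -
  obtain U F where U: "open U" "\<Theta> \<subseteq> U" and F: "complex_real_analytic_on F (U \<times> UNIV)"
    and ext: "\<forall>\<theta>\<in>\<Theta>. \<forall>\<omega>. F (\<theta>, \<omega>) = char_fun (P \<theta>) \<omega>"
    using A4_iii by (elim exE conjE)
  have P: "prob_space (P \<theta>)" "sets (P \<theta>) = sets borel" if "\<theta> \<in> \<Theta>" for \<theta>
    using A3_prob that by auto
  \<comment> \<open>The uniqueness theorem for characteristic functions turns injectivity of the
    laws into separation of the slices of \<open>F\<close>.\<close>
  have sep: "\<exists>\<omega>. F (t, \<omega>) \<noteq> F (t', \<omega>)" if t: "t \<in> \<Theta>" "t' \<in> \<Theta>" "t \<noteq> t'" for t t'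
  proof (rule ccontr)
    assume "\<not> ?thesis"
    then have "char_fun (P t) \<omega> = char_fun (P t') \<omega>" for \<omega> using ext t by simp
    then have "P t = P t'" using P t by (intro prob_measure_eqI_char_fun) auto
    then show False using A4_ii t by (auto dest: inj_onD)
  qed
  have "AE z in M. (\<chi> i. ((\<chi> j. \<Omega> i j z), \<alpha> i z)) \<notin>
      {w :: ((real^'d^'l) \<times> real) ^ 'k. \<exists>t\<in>\<Theta>. \<exists>t'\<in>\<Theta>. t \<noteq> t' \<and>
         (\<forall>i. phase_diff F ((t, t'), w $ i) = 0)}"
    by (rule AE_features_not_in_negligible[OF prob features
          negligible_non_injective_features[OF k F U sep]])
  then show ?thesis
  proof (rule eventually_mono)
    fix z
    assume good: "(\<chi> i. ((\<chi> j. \<Omega> i j z), \<alpha> i z)) \<notin>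
      {w :: ((real^'d^'l) \<times> real) ^ 'k. \<exists>t\<in>\<Theta>. \<exists>t'\<in>\<Theta>. t \<noteq> t' \<and>
         (\<forall>i. phase_diff F ((t, t'), w $ i) = 0)}"
    define \<Phi> where "\<Phi> = (\<lambda>\<theta>. \<integral>x. fourier_features (\<lambda>i j. \<Omega> i j z) (\<lambda>i. \<alpha> i z) x \<partial>P \<theta>)"
    have \<Phi>_nth: "\<Phi> \<theta> $ i = cos (\<alpha> i z) * Re (F (\<theta>, \<chi> j. \<Omega> i j z)) - sin (\<alpha> i z) * Im (F (\<theta>, \<chi> j. \<Omega> i j z))"
      if "\<theta> \<in> \<Theta>" for \<theta> i
      unfolding \<Phi>_def using fourier_features_integral_nth[OF P[OF that]] ext that by simp
    have "inj_on \<Phi> \<Theta>"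
    proof (rule inj_onI, rule ccontr)
      fix t t' assume t: "t \<in> \<Theta>" "t' \<in> \<Theta>" and eq: "\<Phi> t = \<Phi> t'" and ne: "t \<noteq> t'"
      \<comment> \<open>Equality of the expected features in coordinate i is a zero of
        \<open>phase_diff\<close> at the i-th parameter, so a coincidence would put the drawn
        parameters into the null set.\<close>
      have "phase_diff F ((t, t'), ((\<chi> j. \<Omega> i j z), \<alpha> i z)) = 0" for i
      proof -
        have "\<Phi> t $ i - \<Phi> t' $ i = 0" using eq by simp
        then show ?thesis
          unfolding \<Phi>_nth[OF t(1)] \<Phi>_nth[OF t(2)]
          by (simp add: phase_diff_def slice_diff_def algebra_simps)
      qed
      with good t ne show False by auto
    qed
    then show "inj_on (\<lambda>\<theta>. \<integral>x. fourier_features (\<lambda>i j. \<Omega> i j z) (\<lambda>i. \<alpha> i z) x \<partial>P \<theta>) \<Theta>"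
      unfolding \<Phi>_def .
  qed
qed

end
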